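(* Let $I \subset S = \mathbb{C}[x_1,\dots,x_r]$ be a homogeneous ideal generated in degrees $\le n$, and let $x^{J_1},\dots,x^{J_N}$ be the minimal generators of $\mathrm{gin}(I)$ of degree $\le n$. Then every minimal generator $P$ of $\mathrm{gin}(I)$ of degree $n+1$ satisfies $P \prec x_i x^{J_j}$ for some $j$ with $|J_j| = n$ and some index $i < \max(J_j)$.
   Context: $\mathrm{gin}(I)$ denotes the generic initial ideal of $I$ with respect to the reverse lexicographic order $\succ$ with $x_1 \succ x_2 \succ \cdots \succ x_r$ (the initial ideal of $I$ after a generic linear change of coordinates); it is a Borel-fixed monomial ideal. For an exponent vector $J = (j_1,\dots,j_r)$, $x^J = x_1^{j_1}\cdots x_r^{j_r}$, $|J| = j_1+\cdots+j_r$, and $\max(J) = \max\{ i \mid j_i > 0\}$. The symbol $\prec$ denotes comparison in the reverse lexicographic order. *)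

theory Defs
  imports Complex_Main "HOL-Library.Poly_Mapping"
begin

text \<open>Multivariate polynomials over the complex numbers, modelled as finitely supported
  functions from exponent vectors (monomials) to coefficients.  The variables are
  indexed by natural numbers; the polynomial ring S = C[x_1,...,x_r] consists of the
  polynomials all of whose monomials only involve the variables with index in {1..r}.\<close>

type_synonym mon = "nat \<Rightarrow>\<^sub>0 nat"
type_synonym cpoly = "mon \<Rightarrow>\<^sub>0 complex"

definition mon_in :: "nat \<Rightarrow> mon \<Rightarrow> bool" where
  "mon_in r m \<longleftrightarrow> Poly_Mapping.keys m \<subseteq> {1..r}"

definition polyring :: "nat \<Rightarrow> cpoly set" where
  "polyring r = {p. \<forall>m\<in>Poly_Mapping.keys p. mon_in r m}"

definition mdeg :: "mon \<Rightarrow> nat" where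
  "mdeg m = (\<Sum>i\<in>Poly_Mapping.keys m. Poly_Mapping.lookup m i)"

definition maxvar :: "mon \<Rightarrow> nat" where
  "maxvar m = (if Poly_Mapping.keys m = {} then 0 else Max (Poly_Mapping.keys m))"

definition xmon :: "mon \<Rightarrow> cpoly" where
  "xmon J = Poly_Mapping.single J 1"

definition var :: "nat \<Rightarrow> mon" where
  "var i = Poly_Mapping.single i 1"

definition homog_of_deg :: "nat \<Rightarrow> cpoly \<Rightarrow> bool" where
  "homog_of_deg d p \<longleftrightarrow> (\<forall>m\<in>Poly_Mapping.keys p. mdeg m = d)"

definition is_ideal :: "nat \<Rightarrow> cpoly set \<Rightarrow> bool" where
  "is_ideal r I \<longleftrightarrow> I \<subseteq> polyring r \<and> 0 \<in> I \<and>
     (\<forall>p\<in>I. \<forall>q\<in>I. p + q \<in> I) \<and>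
     (\<forall>p\<in>I. \<forall>q\<in>polyring r. q * p \<in> I)"

definition ideal_gen :: "nat \<Rightarrow> cpoly set \<Rightarrow> cpoly set" where
  "ideal_gen r G = \<Inter>{J. is_ideal r J \<and> G \<subseteq> J}"

text \<open>The graded reverse lexicographic order with x_1 > x_2 > ... > x_r:
  revlex_less A B means x^A \<prec> x^B.  For monomials of equal degree,
  x^A \<prec> x^B iff the last nonzero entry of A - B is positive.\<close>
definition revlex_less :: "mon \<Rightarrow> mon \<Rightarrow> bool" where
  "revlex_less A B \<longleftrightarrow> mdeg A < mdeg B \<or>
     (mdeg A = mdeg B \<and> A \<noteq> B \<and>
        (let k = Max {i. Poly_Mapping.lookup A i \<noteq> Poly_Mapping.lookup B i} in Poly_Mapping.lookup A k > Poly_Mapping.lookup B k))"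

definition lead_mon :: "cpoly \<Rightarrow> mon" where
  "lead_mon p = (THE m. m \<in> Poly_Mapping.keys p \<and> (\<forall>m'\<in>Poly_Mapping.keys p. m' \<noteq> m \<longrightarrow> revlex_less m' m))"

definition initial_ideal :: "nat \<Rightarrow> cpoly set \<Rightarrow> cpoly set" where
  "initial_ideal r I = ideal_gen r {xmon (lead_mon p) | p. p \<in> I \<and> p \<noteq> 0}"

definition subst :: "(nat \<Rightarrow> cpoly) \<Rightarrow> cpoly \<Rightarrow> cpoly" where
  "subst \<sigma> p = (\<Sum>m\<in>Poly_Mapping.keys p. Poly_Mapping.single 0 (Poly_Mapping.lookup p m) *
                    (\<Prod>j\<in>Poly_Mapping.keys m. (\<sigma> j) ^ Poly_Mapping.lookup m j))"

definition invertible_mat :: "nat \<Rightarrow> (nat \<Rightarrow> nat \<Rightarrow> complex) \<Rightarrow> bool" where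
  "invertible_mat r g \<longleftrightarrow> (\<exists>h. \<forall>i\<in>{1..r}. \<forall>j\<in>{1..r}.
      (\<Sum>k=1..r. g i k * h k j) = (if i = j then 1 else 0))"

definition lin_subst :: "nat \<Rightarrow> (nat \<Rightarrow> nat \<Rightarrow> complex) \<Rightarrow> nat \<Rightarrow> cpoly" where
  "lin_subst r g j = (\<Sum>i=1..r. Poly_Mapping.single (var i) (g i j))"

definition act :: "nat \<Rightarrow> (nat \<Rightarrow> nat \<Rightarrow> complex) \<Rightarrow> cpoly set \<Rightarrow> cpoly set" where
  "act r g I = subst (lin_subst r g) ` I"

text \<open>Polynomials in the r^2 matrix entries, used to describe Zariski-open subsets
  of GL_r(C): the nonvanishing set of a nonzero such polynomial F.\<close>
definition entry_poly :: "nat \<Rightarrow> (((nat \<times> nat) \<Rightarrow>\<^sub>0 nat) \<Rightarrow>\<^sub>0 complex) \<Rightarrow> bool" where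
  "entry_poly r F \<longleftrightarrow> (\<forall>m\<in>Poly_Mapping.keys F. Poly_Mapping.keys m \<subseteq> {1..r} \<times> {1..r})"

definition eval_entry :: "(((nat \<times> nat) \<Rightarrow>\<^sub>0 nat) \<Rightarrow>\<^sub>0 complex) \<Rightarrow> (nat \<Rightarrow> nat \<Rightarrow> complex) \<Rightarrow> complex" where
  "eval_entry F g = (\<Sum>m\<in>Poly_Mapping.keys F. Poly_Mapping.lookup F m * (\<Prod>ij\<in>Poly_Mapping.keys m. g (fst ij) (snd ij) ^ Poly_Mapping.lookup m ij))"

text \<open>M is the generic initial ideal of I: there is a nonempty Zariski-open subset U of
  GL_r(C) (complement of the zero set of a nonzero polynomial F in the entries) such that
  in(gI) = M for all g \<in> U.  (By Galligo's theorem such M exists and is unique.)\<close>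
definition is_gin :: "nat \<Rightarrow> cpoly set \<Rightarrow> cpoly set \<Rightarrow> bool" where
  "is_gin r I M \<longleftrightarrow> (\<exists>F. F \<noteq> 0 \<and> entry_poly r F \<and>
      (\<forall>g. invertible_mat r g \<and> eval_entry F g \<noteq> 0 \<longrightarrow> initial_ideal r (act r g I) = M))"

definition mon_dvd :: "mon \<Rightarrow> mon \<Rightarrow> bool" where
  "mon_dvd K J \<longleftrightarrow> (\<forall>i. Poly_Mapping.lookup K i \<le> Poly_Mapping.lookup J i)"

definition min_gen :: "cpoly set \<Rightarrow> mon \<Rightarrow> bool" where
  "min_gen M J \<longleftrightarrow> xmon J \<in> M \<and> (\<forall>K. xmon K \<in> M \<and> mon_dvd K J \<longrightarrow> K = J)"

end

theory Submission
  imports Defs "HOL-Library.Nat_Bijection" "Jordan_Normal_Form.Determinant"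
begin

text \<open>Fix a generic coordinate change and let \<open>V\<close> be the transformed ideal, with set of leading
  monomials \<open>L\<close>.

  First, \<open>L\<close> is strongly stable. Suppose \<open>x_j u\<close> lies in \<open>L\<close> but \<open>x_i u\<close> does not, where \<open>i < j\<close>. Let
  \<open>K\<close> be the set of monomials of \<open>L\<close> of the same degree that are at least \<open>x_i u\<close>. Generically the
  coefficients at monomials \<open>\<ge> x_i u\<close> have rank \<open>|K|\<close> on that degree of the ideal. Degenerating the
  elements with leading monomials \<open>K \<union> {x_j u}\<close> to these monomials by a one-parameter torus and then
  applying \<open>x_j \<mapsto> x_j + x_i\<close> yields rank \<open>|K| + 1\<close> (trailing monomials are distinct in characteristic
  zero), and the rank is lower semicontinuous: a contradiction.

  Second, choose \<open>f_m\<close> in \<open>V\<close> with leading monomial \<open>m\<close> for all \<open>m\<close> in \<open>L\<close> of degree \<open>n\<close>, with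
  \<open>f_m = x_k f'\<close>, \<open>k = max m\<close>, whenever \<open>m\<close> is not a minimal generator. By stability and induction on
  \<open>x_i m\<close>, the degree \<open>n + 1\<close> part of \<open>V\<close> is spanned by the \<open>x_k f_m\<close> with \<open>k \<ge> max m\<close>, whose leading
  monomials are distinct, together with the \<open>x_i f_m\<close> where \<open>m\<close> is a minimal generator and
  \<open>i < max m\<close>. A leading monomial that is not a multiple of one of degree \<open>n\<close> can only arise by
  cancellation against the latter, so it is smaller than some \<open>x_i m\<close>.\<close>

abbreviation "lookup \<equiv> Poly_Mapping.lookup"
abbreviation "keys \<equiv> Poly_Mapping.keys"
abbreviation "single \<equiv> Poly_Mapping.single"

section \<open>Monomials and the reverse lexicographic order\<close>

lemma mdeg_eq_sum: "finite A \<Longrightarrow> keys m \<subseteq> A \<Longrightarrow> mdeg m = sum (lookup m) A"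
  unfolding mdeg_def by (rule sum.mono_neutral_left) (auto simp: in_keys_iff)

lemma mdeg_add: "mdeg (a + b) = mdeg a + mdeg b"
proof -
  let ?A = "keys a \<union> keys b"
  have "mdeg (a + b) = sum (lookup (a + b)) ?A"
    by (rule mdeg_eq_sum) (auto simp: in_keys_iff lookup_add)
  also have "\<dots> = sum (lookup a) ?A + sum (lookup b) ?A"
    by (simp add: lookup_add sum.distrib)
  also have "\<dots> = mdeg a + mdeg b"
    by (simp add: mdeg_eq_sum[of ?A])
  finally show ?thesis .
qed

lemma mdeg_var [simp]: "mdeg (var i) = 1"
  by (simp add: mdeg_def var_def)

lemma mdeg_0 [simp]: "mdeg 0 = 0"
  by (simp add: mdeg_def)

lemma lookup_var: "lookup (var i) k = (if k = i then 1 else 0)"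
  by (auto simp: var_def lookup_single)

lemma lookup_le_mdeg: "lookup m i \<le> mdeg m"
proof -
  have "lookup m i \<le> sum (lookup m) (insert i (keys m))"
    by (rule member_le_sum) auto
  then show ?thesis by (simp add: mdeg_eq_sum[of "insert i (keys m)"] subset_insertI)
qed

lemma mon_eq_add_var:
  assumes "0 < lookup m k"
  obtains u where "m = u + var k"
proof
  have le: "lookup (var k) i \<le> lookup m i" for i
    using assms by (auto simp: lookup_var)
  show "m = (m - var k) + var k"
    by (rule poly_mapping_eqI) (use le in \<open>simp add: lookup_add lookup_minus\<close>)
qed

lemma mon_in_add [simp]: "mon_in r (a + b) \<longleftrightarrow> mon_in r a \<and> mon_in r b"
  unfolding mon_in_def subset_iff in_keys_iff lookup_add by auto

lemma mon_in_var [simp]: "mon_in r (var i) \<longleftrightarrow> 1 \<le> i \<and> i \<le> r"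
  by (auto simp: mon_in_def var_def)

lemma mon_in_0 [simp]: "mon_in r 0"
  by (simp add: mon_in_def)

lemma le_maxvar: "0 < lookup m i \<Longrightarrow> i \<le> maxvar m"
  by (auto simp: maxvar_def in_keys_iff)

lemma lookup_maxvar_pos: "m \<noteq> 0 \<Longrightarrow> 0 < lookup m (maxvar m)"
  using Max_in[of "keys m"] by (auto simp: maxvar_def in_keys_iff)

lemma maxvar_le_iff: "maxvar m \<le> k \<longleftrightarrow> (\<forall>i>k. lookup m i = 0)"
proof
  assume "maxvar m \<le> k"
  then show "\<forall>i>k. lookup m i = 0"
    using le_maxvar[of m] by (meson gr0I le_trans not_less)
next
  assume *: "\<forall>i>k. lookup m i = 0"
  show "maxvar m \<le> k"
  proof (cases "m = 0")
    case False
    then show ?thesis using * lookup_maxvar_pos[of m] by (metis less_irrefl not_le)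
  qed (simp add: maxvar_def)
qed

text \<open>The index k can be read off from the product, so a monomial factors in only one way as m
  times x_k with k at least max m. This later makes the leading monomials of \<open>B1\<close>
  distinct.\<close>

lemma maxvar_add_var: "maxvar m \<le> k \<Longrightarrow> maxvar (m + var k) = k"
  by (rule antisym)
     (auto simp: maxvar_le_iff lookup_add lookup_var intro!: le_maxvar)

definition mons :: "nat \<Rightarrow> nat \<Rightarrow> mon set" where
  "mons r d = {m. mon_in r m \<and> mdeg m = d}"

lemma finite_mons: "finite (mons r d)"
proof (rule finite_imageD)
  have "lookup ` mons r d \<subseteq> {f. \<forall>x. (x \<in> {1..r} \<longrightarrow> f x \<in> {..d}) \<and> (x \<notin> {1..r} \<longrightarrow> f x = 0)}"
    by (auto simp: mons_def mon_in_def in_keys_iff subset_iff lookup_le_mdeg)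
  then show "finite (lookup ` mons r d)"
    by (rule finite_subset) (intro finite_set_of_finite_funs; simp)
  show "inj_on lookup (mons r d)"
    by (auto simp: inj_on_def intro: poly_mapping_eqI)
qed

text \<open>The witness k is the last position where the exponents differ. Replacing
  \<open>Max\<close> by an existential quantifier makes the order axioms elementary.\<close>

lemma revlex_less_iff:
  "revlex_less A B \<longleftrightarrow> mdeg A < mdeg B \<or>
     mdeg A = mdeg B \<and> (\<exists>k. lookup B k < lookup A k \<and> (\<forall>i>k. lookup A i = lookup B i))"
proof -
  let ?D = "{i. lookup A i \<noteq> lookup B i}"
  have fin: "finite ?D"
    by (rule finite_subset[of _ "keys A \<union> keys B"]) (auto simp: in_keys_iff)
  have "(A \<noteq> B \<and> lookup B (Max ?D) < lookup A (Max ?D)) \<longleftrightarrow>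
      (\<exists>k. lookup B k < lookup A k \<and> (\<forall>i>k. lookup A i = lookup B i))" (is "?l \<longleftrightarrow> ?r")
  proof
    assume ?l
    moreover have "lookup A i = lookup B i" if "i > Max ?D" for i
      using Max_ge[OF fin, of i] that by auto
    ultimately show ?r by blast
  next
    assume ?r
    then obtain k where k: "lookup B k < lookup A k" "\<forall>i>k. lookup A i = lookup B i" by blast
    have "Max ?D = k"
      by (rule Max_eqI[OF fin]) (use k in \<open>auto simp: not_le[symmetric]\<close>)
    then show ?l using k by auto
  qed
  then show ?thesis unfolding revlex_less_def Let_def by blast
qed

lemma revlex_irrefl [simp]: "\<not> revlex_less A A"
  by (simp add: revlex_less_iff)

lemma revlex_trans:
  assumes "revlex_less A B" "revlex_less B C"
  shows "revlex_less A C"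
proof (cases "mdeg A = mdeg B \<and> mdeg B = mdeg C")
  case True
  then obtain k l where
    k: "lookup B k < lookup A k" "\<forall>i>k. lookup A i = lookup B i" and
    l: "lookup C l < lookup B l" "\<forall>i>l. lookup B i = lookup C i"
    using assms by (auto simp: revlex_less_iff)
  have "lookup C (max k l) < lookup A (max k l)"
    using k l by (cases k l rule: linorder_cases) (auto simp: max_def)
  moreover have "\<forall>i>max k l. lookup A i = lookup C i" using k l by simp
  ultimately show ?thesis using True by (auto simp: revlex_less_iff)
next
  case False
  then show ?thesis using assms by (auto simp: revlex_less_iff)
qed

lemma revlex_asym: "revlex_less A B \<Longrightarrow> \<not> revlex_less B A"
  using revlex_trans revlex_irrefl by blast

lemma revlex_total: "A \<noteq> B \<Longrightarrow> revlex_less A B \<or> revlex_less B A"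
proof -
  assume "A \<noteq> B"
  let ?D = "{i. lookup A i \<noteq> lookup B i}"
  have fin: "finite ?D"
    by (rule finite_subset[of _ "keys A \<union> keys B"]) (auto simp: in_keys_iff)
  have ne: "?D \<noteq> {}" using \<open>A \<noteq> B\<close> by (auto intro: poly_mapping_eqI)
  define k where "k = Max ?D"
  have "lookup A k \<noteq> lookup B k" using Max_in[OF fin ne] by (simp add: k_def)
  moreover have "lookup A i = lookup B i" if "i > k" for i
    using Max_ge[OF fin, of i] that by (auto simp: k_def)
  ultimately have "lookup B k < lookup A k \<and> (\<forall>i>k. lookup A i = lookup B i) \<or>
      lookup A k < lookup B k \<and> (\<forall>i>k. lookup B i = lookup A i)"
    by (metis linorder_neqE_nat)
  then show ?thesis
    unfolding revlex_less_iff by (metis linorder_neqE_nat)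
qed

lemma revlex_add_iff [simp]:
  "revlex_less (C + A) (C + B) \<longleftrightarrow> revlex_less A B"
  "revlex_less (A + C) (B + C) \<longleftrightarrow> revlex_less A B"
  by (auto simp: revlex_less_iff mdeg_add lookup_add)

lemma revlex_var: "i < j \<Longrightarrow> revlex_less (var j) (var i)"
  by (auto simp: revlex_less_iff lookup_var intro!: exI[of _ j])

lemma finite_revlex_greatest:
  assumes "finite S" "S \<noteq> {}"
  obtains g where "g \<in> S" "\<And>x. x \<in> S \<Longrightarrow> x \<noteq> g \<Longrightarrow> revlex_less x g"
proof -
  have "\<exists>g\<in>S. \<forall>x\<in>S. x \<noteq> g \<longrightarrow> revlex_less x g"
    by (rule Finite_Set.bex_greatest_element)
       (use assms in \<open>auto intro!: transp_onI totalp_onI asymp_onI intro: revlex_trans dest: revlex_asym revlex_total\<close>)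
  then show ?thesis using that by blast
qed

lemma finite_revlex_least:
  assumes "finite S" "S \<noteq> {}"
  obtains g where "g \<in> S" "\<And>x. x \<in> S \<Longrightarrow> x \<noteq> g \<Longrightarrow> revlex_less g x"
proof -
  have "\<exists>g\<in>S. \<forall>x\<in>S. x \<noteq> g \<longrightarrow> revlex_less g x"
    by (rule Finite_Set.bex_least_element)
       (use assms in \<open>auto intro!: transp_onI totalp_onI asymp_onI intro: revlex_trans dest: revlex_asym revlex_total\<close>)
  then show ?thesis using that by blast
qed

text \<open>There are only finitely many monomials of a fixed degree in r variables, so a nonempty
  set of counterexamples has a least element.\<close>

lemma revlex_mons_induct [consumes 1, case_names less]:
  assumes "w \<in> mons r d"
    and step: "\<And>w. w \<in> mons r d \<Longrightarrow> (\<And>c. c \<in> mons r d \<Longrightarrow> revlex_less c w \<Longrightarrow> Q c) \<Longrightarrow> Q w"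
  shows "Q w"
proof (rule ccontr)
  assume "\<not> Q w"
  then obtain g where "g \<in> {c \<in> mons r d. \<not> Q c}"
    "\<And>x. x \<in> {c \<in> mons r d. \<not> Q c} \<Longrightarrow> x \<noteq> g \<Longrightarrow> revlex_less g x"
    using finite_revlex_least[of "{c \<in> mons r d. \<not> Q c}"] finite_mons assms(1) by auto
  then show False using step[of g] revlex_asym by auto
qed

section \<open>Base-N numerals and weights that represent the order in a fixed degree\<close>

lemma positional_sum_less_power:
  fixes b :: "nat \<Rightarrow> nat"
  assumes "\<And>i. i < k \<Longrightarrow> b i < N"
  shows "(\<Sum>i<k. b i * N ^ i) < N ^ k"
  using assms
proof (induction k)
  case (Suc k)
  have "(\<Sum>i<Suc k. b i * N ^ i) < N ^ k + b k * N ^ k"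
    using Suc by simp
  also have "\<dots> = Suc (b k) * N ^ k" by simp
  also have "\<dots> \<le> N * N ^ k" using Suc.prems[of k] by (intro mult_right_mono) auto
  finally show ?case by simp
qed simp

text \<open>The highest differing digit decides, because the digits of b below position k contribute
  less than N ^ k. This serves both the torus weights and the Kronecker substitution.\<close>

lemma positional_less:
  fixes a b :: "nat \<Rightarrow> nat"
  assumes "\<And>i. b i < N" "b k < a k" "\<And>i. k < i \<Longrightarrow> a i = b i" "k \<le> R"
  shows "(\<Sum>i\<le>R. b i * N ^ i) < (\<Sum>i\<le>R. a i * N ^ i)"
proof -
  have split: "(\<Sum>i\<le>R. f i * N ^ i) = (\<Sum>i<k. f i * N ^ i) + f k * N ^ k + (\<Sum>i\<in>{k<..R}. f i * N ^ i)"
    for f :: "nat \<Rightarrow> nat"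
  proof -
    have "{..R} = {..<Suc k} \<union> {k<..R}" using assms(4) by auto
    moreover have "(\<Sum>i\<in>{..<Suc k} \<union> {k<..R}. f i * N ^ i)
        = (\<Sum>i<Suc k. f i * N ^ i) + (\<Sum>i\<in>{k<..R}. f i * N ^ i)"
      by (rule sum.union_disjoint) auto
    ultimately show ?thesis by simp
  qed
  have "(\<Sum>i<k. b i * N ^ i) + b k * N ^ k < Suc (b k) * N ^ k"
    using positional_sum_less_power[of k b N] assms(1) by simp
  also have "\<dots> \<le> a k * N ^ k" using assms(2) by (intro mult_right_mono) auto
  finally show ?thesis unfolding split using assms(3) by simp
qed

text \<open>The variable x_i gets weight N ^ i. For large N this linear function of the exponents
  refines to the reverse lexicographic order on one degree, and it gives the exponents of the
  one-parameter torus.\<close>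

definition wt :: "nat \<Rightarrow> mon \<Rightarrow> nat" where
  "wt N m = (\<Sum>i\<in>keys m. lookup m i * N ^ i)"

lemma wt_eq_sum: "finite A \<Longrightarrow> keys m \<subseteq> A \<Longrightarrow> wt N m = (\<Sum>i\<in>A. lookup m i * N ^ i)"
  unfolding wt_def by (rule sum.mono_neutral_left) (auto simp: in_keys_iff)

text \<open>In degree d all exponents are below \<open>Suc d\<close>, so they are digits. The order
  is reversed: the larger monomial has the smaller exponent at the last difference, hence the
  smaller weight, and so dominates as the torus parameter tends to 0.\<close>

lemma wt_less:
  assumes "revlex_less A B" "A \<in> mons r d" "B \<in> mons r d"
  shows "wt (Suc d) B < wt (Suc d) A"
proof -
  obtain k where k: "lookup B k < lookup A k" "\<forall>i>k. lookup A i = lookup B i"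
    using assms by (auto simp: revlex_less_iff mons_def)
  have "k \<in> keys A" using k by (auto simp: in_keys_iff)
  then have "k \<le> r" using assms by (auto simp: mons_def mon_in_def)
  have "(\<Sum>i\<le>r. lookup B i * Suc d ^ i) < (\<Sum>i\<le>r. lookup A i * Suc d ^ i)"
    by (rule positional_less[of _ _ k])
       (use k assms lookup_le_mdeg[of B] \<open>k \<le> r\<close> in \<open>auto simp: mons_def less_Suc_eq_le\<close>)
  then show ?thesis using assms by (subst (1 2) wt_eq_sum[of "{..r}"]) (auto simp: mons_def mon_in_def)
qed

section \<open>Polynomials, leading monomials and initial ideals\<close>

lemma lookup_single_mult_add:
  fixes p :: cpoly
  shows "lookup (single a c * p) (a + m) = c * lookup p m"
  by (simp add: lookup_mult lookup_single when_mult Sum_any_when_dependent_prod_left)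

lemma lookup_const_mult [simp]:
  fixes p :: cpoly
  shows "lookup (single 0 c * p) m = c * lookup p m"
  using lookup_single_mult_add[of 0 c p m] by simp

lemma keys_single_mult:
  fixes p :: cpoly
  assumes "c \<noteq> 0"
  shows "keys (single a c * p) = (+) a ` keys p"
proof
  show "keys (single a c * p) \<subseteq> (+) a ` keys p"
    using keys_mult[of "single a c" p] by (auto split: if_splits)
  show "(+) a ` keys p \<subseteq> keys (single a c * p)"
    using assms by (auto simp: in_keys_iff lookup_single_mult_add)
qed

lemma single_mult_neq_0:
  fixes p :: cpoly
  shows "c \<noteq> 0 \<Longrightarrow> p \<noteq> 0 \<Longrightarrow> single a c * p \<noteq> 0"
  using keys_single_mult[of c a p] by force

text \<open>Scalars act as constant polynomials \<open>single 0 c\<close>, which makes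
  \<open>span\<close> and \<open>subspace\<close> available for complex vector spaces of
  polynomials.\<close>

interpretation cpoly: vector_space "\<lambda>c (p :: cpoly). single 0 c * p"
proof
  fix a b :: complex and p q :: cpoly
  show "single 0 a * (p + q) = single 0 a * p + single 0 a * q" by (rule distrib_left)
  show "single 0 (a + b) * p = single 0 a * p + single 0 b * p"
    by (simp add: single_add distrib_right)
  show "single 0 a * (single 0 b * p) = single 0 (a * b) * p"
    by (simp add: mult.assoc[symmetric] mult_single)
  show "single 0 1 * p = p" by simp
qed

text \<open>The coefficient type is left general because the expansion is applied to polynomials and
  also to exponent vectors.\<close>

lemma cpoly_eq_sum_single:
  fixes p :: "'a \<Rightarrow>\<^sub>0 'b::comm_monoid_add"
  shows "p = (\<Sum>m\<in>keys p. single m (lookup p m))"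
proof (rule poly_mapping_eqI)
  fix k
  have "lookup (\<Sum>m\<in>keys p. single m (lookup p m)) k
      = (\<Sum>m\<in>keys p. if m = k then lookup p m else 0)"
    unfolding lookup_sum by (intro sum.cong) (auto simp: lookup_single)
  also have "\<dots> = lookup p k" by (auto simp: in_keys_iff)
  finally show "lookup p k = lookup (\<Sum>m\<in>keys p. single m (lookup p m)) k" by simp
qed

lemma xmon_mult: "xmon a * xmon b = xmon (a + b)"
  by (simp add: xmon_def mult_single)

lemma single_eq_const_xmon: "single a c = single 0 c * xmon a"
  by (simp add: xmon_def mult_single)

lemma polyringD: "p \<in> polyring r \<Longrightarrow> m \<in> keys p \<Longrightarrow> mon_in r m"
  by (simp add: polyring_def)

lemma polyring_single [simp]: "mon_in r a \<Longrightarrow> single a c \<in> polyring r"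
  by (auto simp: polyring_def)

lemma polyring_xmon [simp]: "xmon a \<in> polyring r \<longleftrightarrow> mon_in r a"
  by (auto simp: polyring_def xmon_def)

lemma polyring_0 [simp]: "0 \<in> polyring r"
  by (simp add: polyring_def)

lemma polyring_add: "p \<in> polyring r \<Longrightarrow> q \<in> polyring r \<Longrightarrow> p + q \<in> polyring r"
  using keys_add[of p q] by (auto simp: polyring_def)

lemma polyring_mult: "p \<in> polyring r \<Longrightarrow> q \<in> polyring r \<Longrightarrow> p * q \<in> polyring r"
  using keys_mult[of p q] by (fastforce simp: polyring_def)

lemma polyring_is_ideal: "is_ideal r (polyring r)"
  by (simp add: is_ideal_def polyring_add polyring_mult)

lemma ideal_gen_superset: "G \<subseteq> ideal_gen r G"
  by (auto simp: ideal_gen_def)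

lemma ideal_gen_least: "is_ideal r J \<Longrightarrow> G \<subseteq> J \<Longrightarrow> ideal_gen r G \<subseteq> J"
  by (auto simp: ideal_gen_def)

lemma ideal_gen_is_ideal: "G \<subseteq> polyring r \<Longrightarrow> is_ideal r (ideal_gen r G)"
  using ideal_gen_least[OF polyring_is_ideal, of G r]
  unfolding is_ideal_def[of r "ideal_gen r G"] by (auto simp: ideal_gen_def is_ideal_def)

lemma ideal_mult: "is_ideal r V \<Longrightarrow> p \<in> V \<Longrightarrow> q \<in> polyring r \<Longrightarrow> q * p \<in> V"
  by (simp add: is_ideal_def)

lemma ideal_subspace: "is_ideal r V \<Longrightarrow> cpoly.subspace V"
  by (simp add: cpoly.subspace_def is_ideal_def)

text \<open>Every multiplier is a finite sum of terms, so closure under addition and under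
  multiplication by terms suffices.\<close>

lemma is_idealI_terms:
  assumes "V \<subseteq> polyring r" "0 \<in> V" "\<And>p q. p \<in> V \<Longrightarrow> q \<in> V \<Longrightarrow> p + q \<in> V"
    "\<And>p a c. p \<in> V \<Longrightarrow> mon_in r a \<Longrightarrow> single a c * p \<in> V"
  shows "is_ideal r V"
proof -
  have "q * p \<in> V" if "p \<in> V" "q \<in> polyring r" for p q
  proof -
    have sum_in: "(\<Sum>m\<in>A. g m) \<in> V" if "finite A" "\<And>m. m \<in> A \<Longrightarrow> g m \<in> V" for A :: "mon set" and g
      using that assms(2,3) by (induction A rule: finite_induct) auto
    have "q * p = (\<Sum>m\<in>keys q. single m (lookup q m) * p)"
      by (subst cpoly_eq_sum_single[of q]) (simp add: sum_distrib_right)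
    also have "\<dots> \<in> V"
      using that assms(4) polyringD by (intro sum_in) auto
    finally show ?thesis .
  qed
  then show ?thesis using assms unfolding is_ideal_def by auto
qed

section \<open>Leading monomials and the monomials of the initial ideal\<close>

lemma lead_mon_eqI:
  assumes "m \<in> keys p" "\<And>m'. m' \<in> keys p \<Longrightarrow> m' \<noteq> m \<Longrightarrow> revlex_less m' m"
  shows "lead_mon p = m"
  unfolding lead_mon_def
proof (rule the_equality)
  show "m \<in> keys p \<and> (\<forall>m'\<in>keys p. m' \<noteq> m \<longrightarrow> revlex_less m' m)" using assms by blast
next
  fix k assume k: "k \<in> keys p \<and> (\<forall>m'\<in>keys p. m' \<noteq> k \<longrightarrow> revlex_less m' k)"
  show "k = m"
  proof (rule ccontr)
    assume "k \<noteq> m"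
    then have "revlex_less k m" "revlex_less m k" using k assms by auto
    then show False using revlex_asym by blast
  qed
qed

lemma
  assumes "p \<noteq> 0"
  shows lead_mon_in_keys: "lead_mon p \<in> keys p"
    and revlex_lead_mon: "\<And>m. m \<in> keys p \<Longrightarrow> m \<noteq> lead_mon p \<Longrightarrow> revlex_less m (lead_mon p)"
proof -
  obtain g where g: "g \<in> keys p" "\<And>x. x \<in> keys p \<Longrightarrow> x \<noteq> g \<Longrightarrow> revlex_less x g"
    using finite_revlex_greatest[of "keys p"] assms by auto
  then have "lead_mon p = g" by (rule lead_mon_eqI)
  then show "lead_mon p \<in> keys p" "\<And>m. m \<in> keys p \<Longrightarrow> m \<noteq> lead_mon p \<Longrightarrow> revlex_less m (lead_mon p)"
    using g by auto
qed

lemma lead_mon_single_mult: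
  assumes "c \<noteq> 0" "p \<noteq> 0"
  shows "lead_mon (single a c * p) = a + lead_mon p"
  by (rule lead_mon_eqI)
     (use assms lead_mon_in_keys[of p] revlex_lead_mon[of p] in \<open>auto simp: keys_single_mult\<close>)

definition leads :: "cpoly set \<Rightarrow> mon set" where
  "leads V = {lead_mon p | p. p \<in> V \<and> p \<noteq> 0}"

lemma leads_mon_in: "is_ideal r V \<Longrightarrow> m \<in> leads V \<Longrightarrow> mon_in r m"
  using lead_mon_in_keys by (fastforce simp: leads_def is_ideal_def dest: polyringD)

lemma leads_add:
  assumes "is_ideal r V" "m \<in> leads V" "mon_in r a"
  shows "a + m \<in> leads V"
proof -
  obtain p where p: "p \<in> V" "p \<noteq> 0" "m = lead_mon p" using assms(2) by (auto simp: leads_def)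
  have "single a 1 * p \<in> V" using assms p by (auto intro: ideal_mult)
  moreover have "a + m = lead_mon (single a 1 * p)" using p by (simp add: lead_mon_single_mult)
  ultimately show ?thesis using p single_mult_neq_0[of 1 p a] by (auto simp: leads_def)
qed

text \<open>The polynomials supported on \<open>leads V\<close> form an ideal containing the
  generators of the initial ideal. Hence the initial ideal can be replaced throughout by the set
  \<open>leads V\<close>.\<close>

lemma xmon_in_initial_ideal_iff:
  assumes "is_ideal r V"
  shows "xmon J \<in> initial_ideal r V \<longleftrightarrow> J \<in> leads V"
proof
  assume "J \<in> leads V"
  then show "xmon J \<in> initial_ideal r V"
    using ideal_gen_superset by (fastforce simp: initial_ideal_def leads_def)
next
  let ?N = "{p. keys p \<subseteq> leads V} :: cpoly set"
  have "is_ideal r ?N"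
  proof (rule is_idealI_terms)
    show "?N \<subseteq> polyring r" using leads_mon_in[OF assms] by (auto simp: polyring_def)
    show "p + q \<in> ?N" if "p \<in> ?N" "q \<in> ?N" for p q
      using that keys_add[of p q] by blast
    show "single a c * p \<in> ?N" if "p \<in> ?N" "mon_in r a" for p a c
      using that leads_add[OF assms] by (cases "c = 0") (auto simp: keys_single_mult)
  qed auto
  moreover have "{xmon (lead_mon p) | p. p \<in> V \<and> p \<noteq> 0} \<subseteq> ?N"
    by (auto simp: xmon_def leads_def)
  ultimately have "initial_ideal r V \<subseteq> ?N"
    unfolding initial_ideal_def by (rule ideal_gen_least)
  moreover assume "xmon J \<in> initial_ideal r V"
  ultimately show "J \<in> leads V" by (auto simp: xmon_def)
qed

section \<open>Homogeneous ideals\<close>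

definition hcomp :: "nat \<Rightarrow> cpoly \<Rightarrow> cpoly" where
  "hcomp d p = Poly_Mapping.mapp (\<lambda>m c. if mdeg m = d then c else 0) p"

lemma lookup_hcomp: "lookup (hcomp d p) m = (if mdeg m = d then lookup p m else 0)"
  by (simp add: hcomp_def lookup_mapp when_def in_keys_iff)

lemma homog_hcomp: "homog_of_deg d (hcomp d p)"
  by (auto simp: homog_of_deg_def in_keys_iff lookup_hcomp split: if_splits)

lemma hcomp_homog: "homog_of_deg d p \<Longrightarrow> hcomp e p = (if e = d then p else 0)"
  by (rule poly_mapping_eqI) (auto simp: lookup_hcomp homog_of_deg_def in_keys_iff)

lemma hcomp_0 [simp]: "hcomp d 0 = 0"
  by (rule poly_mapping_eqI) (simp add: lookup_hcomp)

lemma hcomp_add: "hcomp d (p + q) = hcomp d p + hcomp d q"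
  by (rule poly_mapping_eqI) (simp add: lookup_hcomp lookup_add)

lemma hcomp_single_mult:
  "hcomp d (single a c * p) = (if mdeg a \<le> d then single a c * hcomp (d - mdeg a) p else 0)"
proof (cases "c = 0")
  case False
  show ?thesis
  proof (rule poly_mapping_eqI)
    fix k
    show "lookup (hcomp d (single a c * p)) k =
      lookup (if mdeg a \<le> d then single a c * hcomp (d - mdeg a) p else 0) k"
    proof (cases "\<exists>m. k = a + m")
      case True
      then show ?thesis
        by (auto simp: lookup_hcomp lookup_single_mult_add mdeg_add)
    next
      case False
      then have "k \<notin> (+) a ` X" for X by auto
      then have "lookup (single a c * q) k = 0" for q :: cpoly
        using keys_single_mult[OF \<open>c \<noteq> 0\<close>] by (metis in_keys_iff)
      then show ?thesis by (simp add: lookup_hcomp)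
    qed
  qed
qed simp

lemma homog_0 [simp]: "homog_of_deg d 0"
  by (simp add: homog_of_deg_def)

lemma homog_add: "homog_of_deg d p \<Longrightarrow> homog_of_deg d q \<Longrightarrow> homog_of_deg d (p + q)"
  using keys_add[of p q] by (auto simp: homog_of_deg_def)

lemma homog_mult: "homog_of_deg d p \<Longrightarrow> homog_of_deg e q \<Longrightarrow> homog_of_deg (d + e) (p * q)"
  using keys_mult[of p q] by (fastforce simp: homog_of_deg_def mdeg_add)

lemma homog_single: "homog_of_deg (mdeg a) (single a c)"
  by (simp add: homog_of_deg_def)

lemma homog_const_mult: "homog_of_deg d p \<Longrightarrow> homog_of_deg d (single 0 c * p)"
  using homog_mult[OF homog_single[of 0 c]] by simp

lemma homog_subspace: "cpoly.subspace {p. homog_of_deg d p}"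
  by (simp add: cpoly.subspace_def homog_add homog_const_mult)

lemma homog_keys_mons:
  "p \<in> polyring r \<Longrightarrow> homog_of_deg d p \<Longrightarrow> keys p \<subseteq> mons r d"
  by (auto simp: mons_def homog_of_deg_def polyring_def)

definition homog_ideal :: "nat \<Rightarrow> cpoly set \<Rightarrow> bool" where
  "homog_ideal r V \<longleftrightarrow> is_ideal r V \<and> (\<forall>p\<in>V. \<forall>d. hcomp d p \<in> V)"

text \<open>The component in degree \<open>mdeg m\<close> of an element with leading monomial m
  keeps its leading term; dividing by the leading coefficient makes it monic.\<close>

lemma leads_homogE:
  assumes "homog_ideal r V" "m \<in> leads V"
  obtains f where "f \<in> V" "homog_of_deg (mdeg m) f" "lead_mon f = m" "lookup f m = 1" "f \<noteq> 0"
proof -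
  obtain p where p: "p \<in> V" "p \<noteq> 0" "m = lead_mon p" using assms(2) by (auto simp: leads_def)
  let ?c = "inverse (lookup p m)"
  let ?f = "single 0 ?c * hcomp (mdeg m) p"
  have m: "lookup p m \<noteq> 0" using lead_mon_in_keys[of p] p by (simp add: in_keys_iff)
  have "lookup ?f m = 1" using m by (simp add: lookup_hcomp)
  moreover have "?f \<in> V"
    using assms(1) p by (auto simp: homog_ideal_def intro!: ideal_mult)
  moreover have "homog_of_deg (mdeg m) ?f" by (intro homog_const_mult homog_hcomp)
  moreover have "lead_mon ?f = m"
  proof (rule lead_mon_eqI)
    show "m \<in> keys ?f" using \<open>lookup ?f m = 1\<close> by (simp add: in_keys_iff del: lookup_const_mult)
    fix k assume "k \<in> keys ?f" "k \<noteq> m"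
    then have "k \<in> keys p" by (auto simp: in_keys_iff lookup_hcomp split: if_splits)
    then show "revlex_less k m" using revlex_lead_mon[of p k] p \<open>k \<noteq> m\<close> by auto
  qed
  moreover have "?f \<noteq> 0" using \<open>lookup ?f m = 1\<close> by (metis lookup_zero zero_neq_one)
  ultimately show ?thesis using that by blast
qed

text \<open>Both claims hold because \<open>?X\<close> is an ideal containing \<open>G\<close>: a
  generator of degree at most n has zero component in degree \<open>Suc n\<close>. The second claim
  says that degree \<open>Suc n\<close> is obtained from degree n by multiplying with
  variables.\<close>

lemma homog_ideal_gen:
  assumes "G \<subseteq> polyring r" "\<And>q. q \<in> G \<Longrightarrow> \<exists>d\<le>n. homog_of_deg d q"
  shows "homog_ideal r (ideal_gen r G)"
    and "p \<in> ideal_gen r G \<Longrightarrow> homog_of_deg (Suc n) p \<Longrightarrow>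
      p \<in> cpoly.span {xmon (var i) * f | i f. 1 \<le> i \<and> i \<le> r \<and> f \<in> ideal_gen r G \<and> homog_of_deg n f}"
proof -
  let ?V = "ideal_gen r G"
  let ?B = "{xmon (var i) * f | i f. 1 \<le> i \<and> i \<le> r \<and> f \<in> ?V \<and> homog_of_deg n f}"
  let ?X = "{p \<in> ?V. (\<forall>d. hcomp d p \<in> ?V) \<and> hcomp (Suc n) p \<in> cpoly.span ?B}"
  have V: "is_ideal r ?V" by (rule ideal_gen_is_ideal[OF assms(1)])
  have "is_ideal r ?X"
  proof (rule is_idealI_terms)
    show "?X \<subseteq> polyring r" using V by (auto simp: is_ideal_def)
    show "0 \<in> ?X" using V by (auto simp: is_ideal_def intro: cpoly.span_zero)
    show "p + q \<in> ?X" if "p \<in> ?X" "q \<in> ?X" for p q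
      using that V by (auto simp: is_ideal_def hcomp_add intro: cpoly.span_add)
    fix p a c assume p: "p \<in> ?X" and a: "mon_in r a"
    have "hcomp d (single a c * p) \<in> ?V" for d
      using p a V cpoly.subspace_0[OF ideal_subspace[OF V]]
      by (auto simp: hcomp_single_mult intro: ideal_mult)
    moreover have "single a c * p \<in> ?V" using p a V by (auto intro: ideal_mult)
    moreover have "hcomp (Suc n) (single a c * p) \<in> cpoly.span ?B"
    proof (cases "a = 0")
      case True
      then show ?thesis using p by (simp add: hcomp_single_mult cpoly.span_scale)
    next
      case a0: False
      \<comment> \<open>A nonconstant multiplier a is split as b times x_i; b then multiplies a
        component of p into degree n exactly.\<close>
      then obtain i where "0 < lookup a i" using lookup_maxvar_pos by blast
      then obtain b where b: "a = b + var i" by (rule mon_eq_add_var)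
      show ?thesis
      proof (cases "mdeg a \<le> Suc n")
        case True
        let ?f = "single b c * hcomp (Suc n - mdeg a) p"
        have "homog_of_deg (mdeg b + (Suc n - mdeg a)) ?f"
          by (intro homog_mult homog_single homog_hcomp)
        moreover have "mdeg b + (Suc n - mdeg a) = n" using True b by (simp add: mdeg_add)
        ultimately have "homog_of_deg n ?f" by simp
        moreover have "?f \<in> ?V" using p a b V by (auto intro: ideal_mult)
        ultimately have "xmon (var i) * ?f \<in> ?B" using a b by auto
        moreover have "hcomp (Suc n) (single a c * p) = xmon (var i) * ?f"
          using True by (simp add: hcomp_single_mult xmon_def mult.assoc[symmetric] mult_single b add.commute)
        ultimately show ?thesis by (auto intro: cpoly.span_base)
      qed (simp add: hcomp_single_mult cpoly.span_zero)
    qed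
    ultimately show "single a c * p \<in> ?X" by blast
  qed
  moreover have "G \<subseteq> ?X"
  proof
    fix q assume "q \<in> G"
    then obtain d where d: "d \<le> n" "homog_of_deg d q" using assms(2) by blast
    then show "q \<in> ?X"
      using \<open>q \<in> G\<close> ideal_gen_superset[of G r] V
      by (auto simp: hcomp_homog[OF d(2)] is_ideal_def intro: cpoly.span_zero)
  qed
  ultimately have X: "?V \<subseteq> ?X" by (rule ideal_gen_least)
  then show "homog_ideal r ?V" using V by (auto simp: homog_ideal_def)
  show "p \<in> cpoly.span ?B" if "p \<in> ?V" "homog_of_deg (Suc n) p"
    using X that hcomp_homog[OF that(2), of "Suc n"] by auto
qed

section \<open>Linear substitutions\<close>

definition monsub :: "(nat \<Rightarrow> cpoly) \<Rightarrow> mon \<Rightarrow> cpoly" where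
  "monsub \<sigma> m = (\<Prod>j\<in>keys m. \<sigma> j ^ lookup m j)"

lemma monsub_eq_prod:
  "finite A \<Longrightarrow> keys m \<subseteq> A \<Longrightarrow> monsub \<sigma> m = (\<Prod>j\<in>A. \<sigma> j ^ lookup m j)"
  unfolding monsub_def by (rule prod.mono_neutral_left) (auto simp: in_keys_iff)

lemma monsub_0 [simp]: "monsub \<sigma> 0 = 1"
  by (simp add: monsub_def)

lemma monsub_add: "monsub \<sigma> (a + b) = monsub \<sigma> a * monsub \<sigma> b"
proof -
  let ?A = "keys a \<union> keys b"
  have "monsub \<sigma> (a + b) = (\<Prod>j\<in>?A. \<sigma> j ^ lookup (a + b) j)"
    by (rule monsub_eq_prod) (auto simp: in_keys_iff lookup_add)
  also have "\<dots> = (\<Prod>j\<in>?A. \<sigma> j ^ lookup a j) * (\<Prod>j\<in>?A. \<sigma> j ^ lookup b j)"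
    by (simp add: lookup_add power_add prod.distrib)
  also have "\<dots> = monsub \<sigma> a * monsub \<sigma> b"
    by (simp add: monsub_eq_prod[of ?A])
  finally show ?thesis .
qed

lemma monsub_var [simp]: "monsub \<sigma> (var j) = \<sigma> j"
  by (simp add: monsub_def var_def)

lemma subst_eq_sum:
  assumes "finite A" "keys p \<subseteq> A"
  shows "subst \<sigma> p = (\<Sum>m\<in>A. single 0 (lookup p m) * monsub \<sigma> m)"
  unfolding subst_def monsub_def[symmetric]
  by (rule sum.mono_neutral_left) (use assms in \<open>auto simp: in_keys_iff\<close>)

lemma subst_0 [simp]: "subst \<sigma> 0 = 0"
  by (simp add: subst_def)

lemma subst_add: "subst \<sigma> (p + q) = subst \<sigma> p + subst \<sigma> q"
proof -
  let ?A = "keys p \<union> keys q"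
  have "subst \<sigma> (p + q) = (\<Sum>m\<in>?A. single 0 (lookup (p + q) m) * monsub \<sigma> m)"
    by (rule subst_eq_sum) (auto simp: in_keys_iff lookup_add)
  also have "\<dots> = subst \<sigma> p + subst \<sigma> q"
    by (simp add: subst_eq_sum[of ?A] lookup_add single_add distrib_right sum.distrib)
  finally show ?thesis .
qed

lemma subst_sum: "subst \<sigma> (sum f A) = (\<Sum>x\<in>A. subst \<sigma> (f x))"
  by (induction A rule: infinite_finite_induct) (auto simp: subst_add)

lemma subst_single: "subst \<sigma> (single m c) = single 0 c * monsub \<sigma> m"
  by (subst subst_eq_sum[of "{m}"]) auto

lemma subst_const_mult: "subst \<sigma> (single 0 c * p) = single 0 c * subst \<sigma> p"
  by (subst (1 2) subst_eq_sum[of "keys p"])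
     (auto simp: in_keys_iff sum_distrib_left mult.assoc[symmetric] mult_single)

lemma subst_mult: "subst \<sigma> (p * q) = subst \<sigma> p * subst \<sigma> q"
proof -
  have single: "subst \<sigma> (single a c * single b d) = subst \<sigma> (single a c) * subst \<sigma> (single b d)"
    for a b c d
  proof -
    have "single 0 (c * d) * (monsub \<sigma> a * monsub \<sigma> b)
        = (single 0 c * single 0 d) * (monsub \<sigma> a * monsub \<sigma> b)"
      by (simp add: mult_single)
    then show ?thesis by (simp add: mult_single subst_single monsub_add ac_simps)
  qed
  have "subst \<sigma> (p * q) =
      subst \<sigma> (\<Sum>a\<in>keys p. \<Sum>b\<in>keys q. single a (lookup p a) * single b (lookup q b))"
    by (subst (1) cpoly_eq_sum_single[of p], subst (1) cpoly_eq_sum_single[of q])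
       (simp add: sum_product)
  also have "\<dots> = (\<Sum>a\<in>keys p. subst \<sigma> (single a (lookup p a))) *
      (\<Sum>b\<in>keys q. subst \<sigma> (single b (lookup q b)))"
    by (simp add: subst_sum single sum_product)
  also have "\<dots> = subst \<sigma> p * subst \<sigma> q"
    unfolding subst_sum[symmetric] cpoly_eq_sum_single[symmetric] ..
  finally show ?thesis .
qed

lemma subst_1 [simp]: "subst \<sigma> 1 = 1"
  using subst_single[of \<sigma> 0 1] by simp

lemma subst_power: "subst \<sigma> (p ^ k) = subst \<sigma> p ^ k"
  by (induction k) (auto simp: subst_mult)

lemma subst_prod: "subst \<sigma> (prod f A) = (\<Prod>x\<in>A. subst \<sigma> (f x))"
  by (induction A rule: infinite_finite_induct) (auto simp: subst_mult)

lemma subst_monsub: "subst \<tau> (monsub \<sigma> m) = monsub (\<lambda>j. subst \<tau> (\<sigma> j)) m"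
  by (simp add: monsub_def subst_prod subst_power)

lemma subst_subst: "subst \<tau> (subst \<sigma> p) = subst (\<lambda>j. subst \<tau> (\<sigma> j)) p"
  by (subst (2 3) subst_eq_sum[of "keys p"]) (auto simp: subst_sum subst_const_mult subst_monsub)

lemma subst_cong:
  assumes "p \<in> polyring r" "\<And>j. 1 \<le> j \<Longrightarrow> j \<le> r \<Longrightarrow> \<sigma> j = \<tau> j"
  shows "subst \<sigma> p = subst \<tau> p"
  unfolding subst_def
  by (intro sum.cong arg_cong2[where f = "(*)"] prod.cong refl)
     (use assms in \<open>auto simp: polyring_def mon_in_def subset_iff\<close>)

lemma xmon_var_power: "xmon (var j) ^ k = xmon (single j k)"
proof (induction k)
  case (Suc k)
  then show ?case by (simp add: xmon_mult var_def single_add[symmetric])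
qed (simp add: xmon_def)

lemma monsub_xmon_var: "monsub (\<lambda>j. xmon (var j)) m = xmon m"
proof -
  have "(\<Prod>j\<in>A. xmon (single j (lookup m j))) = xmon (\<Sum>j\<in>A. single j (lookup m j))" if "finite A" for A
    using that by (induction A rule: finite_induct) (auto simp: xmon_mult, simp add: xmon_def)
  then show ?thesis unfolding monsub_def xmon_var_power by (simp add: cpoly_eq_sum_single[symmetric])
qed

lemma subst_xmon_var: "subst (\<lambda>j. xmon (var j)) p = p"
  by (subst (2) cpoly_eq_sum_single[of p])
     (simp add: subst_eq_sum[of "keys p"] monsub_xmon_var single_eq_const_xmon[symmetric])

section \<open>Matrix products and the action of matrices on ideals\<close>

definition mmul :: "nat \<Rightarrow> (nat \<Rightarrow> nat \<Rightarrow> complex) \<Rightarrow> (nat \<Rightarrow> nat \<Rightarrow> complex) \<Rightarrow> nat \<Rightarrow> nat \<Rightarrow> complex" where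
  "mmul r h g i j = (\<Sum>k=1..r. h i k * g k j)"

lemma mmul_assoc: "mmul r (mmul r a b) c = mmul r a (mmul r b c)"
  unfolding mmul_def sum_distrib_left sum_distrib_right
  by (intro ext, subst sum.swap) (simp add: mult.assoc)

abbreviation id_mat :: "nat \<Rightarrow> nat \<Rightarrow> complex" where
  "id_mat i j \<equiv> if i = j then 1 else 0"

lemma lin_subst_cong:
  "(\<And>i. 1 \<le> i \<Longrightarrow> i \<le> r \<Longrightarrow> g i j = h i j) \<Longrightarrow> lin_subst r g j = lin_subst r h j"
  unfolding lin_subst_def by (intro sum.cong) auto

lemma lin_subst_id: "1 \<le> j \<Longrightarrow> j \<le> r \<Longrightarrow> lin_subst r id_mat j = xmon (var j)"
  unfolding lin_subst_def
  by (subst sum.remove[of _ j]) (auto simp: xmon_def intro!: sum.neutral)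

text \<open>Column j of a matrix holds the image of x_j, so substituting first g and then h
  corresponds to the product in the order h g.\<close>

lemma subst_lin_subst:
  assumes "1 \<le> j" "j \<le> r"
  shows "subst (lin_subst r h) (lin_subst r g j) = lin_subst r (mmul r h g) j"
proof -
  have "subst (lin_subst r h) (lin_subst r g j) = (\<Sum>k=1..r. single 0 (g k j) * lin_subst r h k)"
    unfolding lin_subst_def[of r g] by (simp add: subst_sum subst_single)
  also have "\<dots> = (\<Sum>k=1..r. \<Sum>i=1..r. single (var i) (h i k * g k j))"
    unfolding lin_subst_def by (simp add: sum_distrib_left mult_single mult.commute)
  also have "\<dots> = (\<Sum>i=1..r. \<Sum>k=1..r. single (var i) (h i k * g k j))"
    by (rule sum.swap)
  also have "\<dots> = lin_subst r (mmul r h g) j"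
  proof -
    have "single a (sum f A) = (\<Sum>x\<in>A. single a (f x))" for a :: mon and f :: "nat \<Rightarrow> complex" and A
      by (induction A rule: infinite_finite_induct) (auto simp: single_add)
    then show ?thesis unfolding lin_subst_def mmul_def by simp
  qed
  finally show ?thesis .
qed

lemma subst_mmul:
  assumes "p \<in> polyring r"
  shows "subst (lin_subst r h) (subst (lin_subst r g) p) = subst (lin_subst r (mmul r h g)) p"
  unfolding subst_subst by (rule subst_cong[OF assms]) (rule subst_lin_subst)

lemma act_act: "V \<subseteq> polyring r \<Longrightarrow> act r h (act r g V) = act r (mmul r h g) V"
  unfolding act_def image_image using subst_mmul by (intro image_cong) auto

text \<open>A right inverse of g gives a right inverse of its substitution, which is therefore
  surjective onto the polynomial ring.\<close>

lemma invertible_matE: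
  assumes "Defs.invertible_mat r g"
  obtains h where "\<And>p. p \<in> polyring r \<Longrightarrow> subst (lin_subst r g) (subst (lin_subst r h) p) = p"
proof -
  obtain h where h: "\<And>i j. i \<in> {1..r} \<Longrightarrow> j \<in> {1..r} \<Longrightarrow> mmul r g h i j = id_mat i j"
    using assms unfolding Defs.invertible_mat_def mmul_def by blast
  have "subst (lin_subst r g) (subst (lin_subst r h) p) = p" if p: "p \<in> polyring r" for p
  proof -
    have "lin_subst r (mmul r g h) j = xmon (var j)" if "1 \<le> j" "j \<le> r" for j
    proof -
      have "lin_subst r (mmul r g h) j = lin_subst r id_mat j"
        by (rule lin_subst_cong) (use that h in auto)
      then show ?thesis using lin_subst_id[OF that] by simp
    qed
    then have "subst (lin_subst r (mmul r g h)) p = subst (\<lambda>j. xmon (var j)) p"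
      by (rule subst_cong[OF p])
    then show ?thesis by (simp add: subst_mmul[OF p] subst_xmon_var)
  qed
  then show ?thesis using that by blast
qed

lemma invertible_mmul:
  assumes "Defs.invertible_mat r g" "Defs.invertible_mat r h"
  shows "Defs.invertible_mat r (mmul r g h)"
proof -
  obtain g' where g': "\<And>i j. i \<in> {1..r} \<Longrightarrow> j \<in> {1..r} \<Longrightarrow> mmul r g g' i j = id_mat i j"
    using assms(1) unfolding Defs.invertible_mat_def mmul_def by blast
  obtain h' where h': "\<And>i j. i \<in> {1..r} \<Longrightarrow> j \<in> {1..r} \<Longrightarrow> mmul r h h' i j = id_mat i j"
    using assms(2) unfolding Defs.invertible_mat_def mmul_def by blast
  have hh: "mmul r (mmul r h h') g' i j = g' i j" if "i \<in> {1..r}" for i j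
  proof -
    have "mmul r (mmul r h h') g' i j = (\<Sum>k=1..r. id_mat i k * g' k j)"
      unfolding mmul_def[of r "mmul r h h'"] by (intro sum.cong) (use h' that in auto)
    also have "\<dots> = (\<Sum>k=1..r. if i = k then g' k j else 0)" by (intro sum.cong) auto
    also have "\<dots> = g' i j" using that by simp
    finally show ?thesis .
  qed
  have "mmul r (mmul r g h) (mmul r h' g') i j = id_mat i j" if "i \<in> {1..r}" "j \<in> {1..r}" for i j
  proof -
    have "mmul r (mmul r g h) (mmul r h' g') i j = mmul r g (mmul r (mmul r h h') g') i j"
      by (simp add: mmul_assoc)
    also have "\<dots> = mmul r g g' i j"
      unfolding mmul_def[of r g] by (intro sum.cong) (use hh in auto)
    finally show ?thesis using g' that by simp
  qed
  then show ?thesis unfolding Defs.invertible_mat_def mmul_def[symmetric] by blast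
qed

lemma monsub_closed:
  assumes "\<And>p q. P p \<Longrightarrow> P q \<Longrightarrow> P (p * q)" "P 1" "\<And>j. P (\<sigma> j)"
  shows "P (monsub \<sigma> m)"
proof -
  have "P (\<sigma> j ^ k)" for j k by (induction k) (use assms in auto)
  then have "P (\<Prod>j\<in>A. \<sigma> j ^ f j)" for A f
    by (induction A rule: infinite_finite_induct) (use assms in auto)
  then show ?thesis by (simp add: monsub_def)
qed

lemma polyring_sum: "(\<And>x. x \<in> A \<Longrightarrow> f x \<in> polyring r) \<Longrightarrow> sum f A \<in> polyring r"
  by (induction A rule: infinite_finite_induct) (auto simp: polyring_add)

lemma homog_sum: "(\<And>x. x \<in> A \<Longrightarrow> homog_of_deg d (f x)) \<Longrightarrow> homog_of_deg d (sum f A)"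
  by (induction A rule: infinite_finite_induct) (auto simp: homog_add)

lemma lin_subst_polyring: "lin_subst r g j \<in> polyring r"
  unfolding lin_subst_def by (rule polyring_sum) auto

lemma subst_polyring: "subst (lin_subst r g) p \<in> polyring r"
proof -
  have one: "1 \<in> polyring r" using polyring_single[of r 0 1] by simp
  have "monsub (lin_subst r g) m \<in> polyring r" for m
    by (rule monsub_closed) (auto simp: polyring_mult lin_subst_polyring one)
  then show ?thesis
    by (subst subst_eq_sum[of "keys p"]) (auto intro!: polyring_sum polyring_mult)
qed

lemma homog_lin_subst: "homog_of_deg 1 (lin_subst r g j)"
  unfolding lin_subst_def
proof (rule homog_sum)
  show "homog_of_deg 1 (single (var i) (g i j))" for i
    using homog_single[of "var i" "g i j"] by simp
qed

lemma homog_monsub: "homog_of_deg (mdeg m) (monsub (lin_subst r g) m)"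
proof -
  have pow: "homog_of_deg k (lin_subst r g j ^ k)" for j k
  proof (induction k)
    case 0
    then show ?case using homog_single[of 0 1] by simp
  next
    case (Suc k)
    then show ?case using homog_mult[OF homog_lin_subst[of r g j] Suc] by simp
  qed
  have "homog_of_deg (sum (lookup m) A) (\<Prod>j\<in>A. lin_subst r g j ^ lookup m j)" if "finite A" for A
    using that
  proof (induction A rule: finite_induct)
    case empty
    then show ?case using homog_single[of 0 1] by simp
  next
    case (insert x A)
    then show ?case using homog_mult[OF pow] by simp
  qed
  then show ?thesis by (simp add: mdeg_def monsub_def)
qed

lemma homog_subst:
  assumes "homog_of_deg d p"
  shows "homog_of_deg d (subst (lin_subst r g) p)"
proof (subst subst_eq_sum[of "keys p"])
  show "homog_of_deg d (\<Sum>m\<in>keys p. single 0 (lookup p m) * monsub (lin_subst r g) m)"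
    by (intro homog_sum homog_const_mult)
       (use assms homog_monsub in \<open>auto simp: homog_of_deg_def\<close>)
qed auto

lemma act_is_ideal:
  assumes "is_ideal r V" "Defs.invertible_mat r g"
  shows "is_ideal r (act r g V)"
proof -
  obtain h where h: "\<And>p. p \<in> polyring r \<Longrightarrow> subst (lin_subst r g) (subst (lin_subst r h) p) = p"
    using invertible_matE[OF assms(2)] by blast
  let ?s = "subst (lin_subst r g)"
  have "q * ?s p \<in> ?s ` V" if "p \<in> V" "q \<in> polyring r" for p q
  proof -
    \<comment> \<open>The multiplier q is pulled back along the right inverse.\<close>
    have "q * ?s p = ?s (subst (lin_subst r h) q * p)"
      using that h by (simp add: subst_mult)
    then show ?thesis using assms(1) that subst_polyring by (auto intro!: imageI ideal_mult)
  qed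
  moreover have "?s p + ?s q \<in> ?s ` V" if "p \<in> V" "q \<in> V" for p q
    using that assms(1) by (auto simp: subst_add[symmetric] is_ideal_def)
  moreover have "0 \<in> ?s ` V"
    using assms(1) by (auto simp: is_ideal_def intro!: image_eqI[of _ _ 0])
  ultimately show ?thesis
    unfolding is_ideal_def act_def using subst_polyring by auto
qed

text \<open>One inclusion pulls the generated ideal back along the substitution; the other holds
  because the image is an ideal. As linear substitutions preserve degrees, the transformed ideal is
  again generated in degrees at most n.\<close>

lemma act_ideal_gen:
  assumes "G \<subseteq> polyring r" "Defs.invertible_mat r g"
  shows "act r g (ideal_gen r G) = ideal_gen r (act r g G)"
proof
  let ?s = "subst (lin_subst r g)"
  have im: "act r g G \<subseteq> polyring r" by (auto simp: act_def subst_polyring)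
  have J: "is_ideal r (ideal_gen r (act r g G))" by (rule ideal_gen_is_ideal[OF im])
  have "is_ideal r {p \<in> polyring r. ?s p \<in> ideal_gen r (act r g G)}"
    using J unfolding is_ideal_def
    by (auto simp: subst_add subst_mult subst_polyring polyring_add polyring_mult)
  moreover have "G \<subseteq> {p \<in> polyring r. ?s p \<in> ideal_gen r (act r g G)}"
    using assms(1) ideal_gen_superset[of "act r g G" r] by (auto simp: act_def)
  ultimately have "ideal_gen r G \<subseteq> {p \<in> polyring r. ?s p \<in> ideal_gen r (act r g G)}"
    by (rule ideal_gen_least)
  then show "act r g (ideal_gen r G) \<subseteq> ideal_gen r (act r g G)" by (auto simp: act_def)
  have "act r g G \<subseteq> act r g (ideal_gen r G)"
    using ideal_gen_superset[of G r] by (auto simp: act_def)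
  then show "ideal_gen r (act r g G) \<subseteq> act r g (ideal_gen r G)"
    by (intro ideal_gen_least act_is_ideal ideal_gen_is_ideal assms)
qed

section \<open>Polynomial families and generic matrices\<close>

text \<open>The map \<open>e\<close> embeds the parameter space: it is the identity for complex-valued families, and
  the inclusion of the constants for families of multivariate polynomials.\<close>

definition polyf :: "('t \<Rightarrow> 'a::comm_ring_1) \<Rightarrow> ('t \<Rightarrow> 'a) \<Rightarrow> bool" where
  "polyf e f \<longleftrightarrow> (\<exists>Q. \<forall>t. f t = poly Q (e t))"

lemma polyf_const: "polyf e (\<lambda>t. c)"
  unfolding polyf_def by (rule exI[of _ "[:c:]"]) simp

lemma polyf_id: "polyf e e"
  unfolding polyf_def by (rule exI[of _ "[:0, 1:]"]) simp

lemma polyf_add: "polyf e f \<Longrightarrow> polyf e g \<Longrightarrow> polyf e (\<lambda>t. f t + g t)"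
  unfolding polyf_def by (metis poly_add)

lemma polyf_mult: "polyf e f \<Longrightarrow> polyf e g \<Longrightarrow> polyf e (\<lambda>t. f t * g t)"
  unfolding polyf_def by (metis poly_mult)

lemma polyf_power: "polyf e f \<Longrightarrow> polyf e (\<lambda>t. f t ^ k)"
  by (induction k) (auto intro: polyf_const polyf_mult)

lemma polyf_sum: "(\<And>x. x \<in> A \<Longrightarrow> polyf e (f x)) \<Longrightarrow> polyf e (\<lambda>t. \<Sum>x\<in>A. f x t)"
  by (induction A rule: infinite_finite_induct) (auto intro: polyf_const polyf_add)

lemma polyf_prod: "(\<And>x. x \<in> A \<Longrightarrow> polyf e (f x)) \<Longrightarrow> polyf e (\<lambda>t. \<Prod>x\<in>A. f x t)"
  by (induction A rule: infinite_finite_induct) (auto intro: polyf_const polyf_mult)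

lemmas polyf_intros = polyf_const polyf_id polyf_add polyf_mult polyf_power polyf_sum polyf_prod

abbreviation cpolyf :: "(complex \<Rightarrow> complex) \<Rightarrow> bool" where
  "cpolyf \<equiv> polyf (\<lambda>t. t)"

lemma cpolyf_finite_zeros:
  assumes "cpolyf f" "f t0 \<noteq> 0"
  shows "finite {t. f t = 0}"
proof -
  obtain Q where Q: "\<And>t. f t = poly Q t" using assms(1) by (auto simp: polyf_def)
  then have "Q \<noteq> 0" using assms(2) by auto
  then show ?thesis using poly_roots_finite[of Q] by (simp add: Q)
qed

lemma finite_bad_ex:
  fixes A B :: "complex set"
  assumes "finite A" "finite B"
  obtains t where "t \<notin> A" "t \<notin> B"
  using ex_new_if_finite[of "A \<union> B"] assms infinite_UNIV_char_0 by auto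

lemma const_power: "(single 0 x :: cpoly) ^ k = single 0 (x ^ k)"
  by (induction k) (auto simp: mult_single)

text \<open>The parameter enters as a constant polynomial, so extracting the coefficient at c from
  each coefficient of \<open>Q\<close> leaves a complex polynomial in t.\<close>

lemma cpolyf_lookup:
  assumes "polyf (single 0) (P :: complex \<Rightarrow> cpoly)"
  shows "cpolyf (\<lambda>t. lookup (P t) c)"
proof -
  obtain Q where Q: "\<And>t. P t = poly Q (single 0 t)" using assms by (auto simp: polyf_def)
  have "lookup (P t) c = (\<Sum>i\<le>degree Q. lookup (coeff Q i) c * t ^ i)" for t
  proof -
    have "lookup (coeff Q i * single 0 (t ^ i)) c = lookup (coeff Q i) c * t ^ i" for i
      using lookup_const_mult[of "t ^ i" "coeff Q i" c] by (simp add: mult.commute)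
    then show ?thesis by (simp add: Q poly_altdef const_power lookup_sum)
  qed
  then show ?thesis by (simp add: polyf_intros)
qed

lemma polyf_subst_line:
  "cpolyf (\<lambda>t. lookup (subst (lin_subst r (\<lambda>i j. a i j + t * b i j)) p) c)"
proof (rule cpolyf_lookup)
  have lin: "polyf (single 0) (\<lambda>t. lin_subst r (\<lambda>i j. a i j + t * b i j) k)" for k
  proof -
    have "single (var i) (a i k + t * b i k) = single (var i) (a i k) + single 0 t * single (var i) (b i k)"
      for i t by (simp add: single_add mult_single)
    then show ?thesis unfolding lin_subst_def by (auto intro!: polyf_intros)
  qed
  show "polyf (single 0) (\<lambda>t. subst (lin_subst r (\<lambda>i j. a i j + t * b i j)) p)"
    unfolding subst_def by (intro polyf_intros lin)
qed

section \<open>Nonsingular square systems that depend on a parameter\<close>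

definition nonsing :: "'b set \<Rightarrow> ('b \<Rightarrow> 'b \<Rightarrow> complex) \<Rightarrow> bool" where
  "nonsing A Q \<longleftrightarrow> (\<forall>v. (\<forall>c\<in>A. (\<Sum>b\<in>A. v b * Q b c) = 0) \<longrightarrow> (\<forall>b\<in>A. v b = 0))"

text \<open>The kernel formulation is what linear relations between polynomials provide; the
  determinant is needed for polynomial dependence on a parameter. Indices are swapped so that the
  row combination v becomes a column vector.\<close>

lemma nonsing_iff_det:
  assumes e: "bij_betw e {0..<n} A"
  shows "nonsing A Q \<longleftrightarrow> det (mat n n (\<lambda>(i, j). Q (e j) (e i))) \<noteq> 0"
proof -
  let ?M = "mat n n (\<lambda>(i, j). Q (e j) (e i))"
  have M: "?M \<in> carrier_mat n n" by simp
  have eA: "e ` {0..<n} = A" using e by (simp add: bij_betw_def)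
  have sum: "(\<Sum>b\<in>A. v b * Q b c) = (\<Sum>j=0..<n. v (e j) * Q (e j) c)" for v c
    using sum.reindex_bij_betw[OF e, of "\<lambda>b. v b * Q b c"] by simp
  have mv: "?M *\<^sub>v w = 0\<^sub>v n \<longleftrightarrow> (\<forall>i<n. (\<Sum>j=0..<n. w $ j * Q (e j) (e i)) = 0)"
    if "w \<in> carrier_vec n" for w
    using that by (auto simp: vec_eq_iff scalar_prod_def mult.commute)
  have "\<not> nonsing A Q \<longleftrightarrow> (\<exists>w. w \<in> carrier_vec n \<and> w \<noteq> 0\<^sub>v n \<and> ?M *\<^sub>v w = 0\<^sub>v n)"
  proof
    assume "\<not> nonsing A Q"
    then obtain v b where v: "\<forall>c\<in>A. (\<Sum>b\<in>A. v b * Q b c) = 0" "b \<in> A" "v b \<noteq> 0"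
      by (auto simp: nonsing_def)
    let ?w = "vec n (\<lambda>j. v (e j))"
    obtain k where k: "k < n" "b = e k" using v(2) eA by auto
    then have "?w \<noteq> 0\<^sub>v n" using v(3) by (auto simp: vec_eq_iff)
    moreover have "?M *\<^sub>v ?w = 0\<^sub>v n"
      using v(1) eA by (subst mv) (auto simp: sum)
    ultimately show "\<exists>w. w \<in> carrier_vec n \<and> w \<noteq> 0\<^sub>v n \<and> ?M *\<^sub>v w = 0\<^sub>v n"
      by (intro exI[of _ ?w]) auto
  next
    assume "\<exists>w. w \<in> carrier_vec n \<and> w \<noteq> 0\<^sub>v n \<and> ?M *\<^sub>v w = 0\<^sub>v n"
    then obtain w where w: "w \<in> carrier_vec n" "w \<noteq> 0\<^sub>v n"
      "\<forall>i<n. (\<Sum>j=0..<n. w $ j * Q (e j) (e i)) = 0" using mv by blast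
    let ?v = "\<lambda>b. w $ (inv_into {0..<n} e b)"
    have inv: "inv_into {0..<n} e (e j) = j" if "j < n" for j
      using e that by (auto simp: bij_betw_def)
    have "(\<Sum>b\<in>A. ?v b * Q b c) = 0" if "c \<in> A" for c
    proof -
      obtain i where "i < n" "c = e i" using eA \<open>c \<in> A\<close> by auto
      then show ?thesis unfolding sum using w(3) inv by simp
    qed
    moreover obtain k where "k < n" "w $ k \<noteq> 0" using w(1,2) by (auto simp: vec_eq_iff)
    then have "e k \<in> A" "?v (e k) \<noteq> 0" using eA inv by auto
    ultimately have "\<not> ((\<forall>c\<in>A. (\<Sum>b\<in>A. ?v b * Q b c) = 0) \<longrightarrow> (\<forall>b\<in>A. ?v b = 0))" by blast
    then show "\<not> nonsing A Q" unfolding nonsing_def by (rule contrapos_nn) (erule spec)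
  qed
  then show ?thesis unfolding det_0_iff_vec_prod_zero_field[OF M] by argo
qed

lemma nonsing_transpose:
  assumes "finite A"
  shows "nonsing A (\<lambda>b c. Q c b) \<longleftrightarrow> nonsing A Q"
proof -
  obtain e where e: "bij_betw e {0..<card A} A" using ex_bij_betw_nat_finite[OF assms] by blast
  let ?n = "card A"
  have "mat ?n ?n (\<lambda>(i, j). Q (e i) (e j)) = transpose_mat (mat ?n ?n (\<lambda>(i, j). Q (e j) (e i)))"
    by (intro eq_matI) auto
  then show ?thesis unfolding nonsing_iff_det[OF e] by (simp add: det_transpose[of _ ?n])
qed

text \<open>The determinant is a polynomial in t that does not vanish at \<open>t0\<close>. This is
  lower semicontinuity of the rank along a line.\<close>

lemma nonsing_cofinite:
  assumes "finite A" "\<And>b c. b \<in> A \<Longrightarrow> c \<in> A \<Longrightarrow> cpolyf (\<lambda>t. Q t b c)" "nonsing A (Q t0)"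
  shows "finite {t. \<not> nonsing A (Q t)}"
proof -
  obtain e where e: "bij_betw e {0..<card A} A" using ex_bij_betw_nat_finite[OF assms(1)] by blast
  let ?n = "card A"
  let ?D = "\<lambda>t. det (mat ?n ?n (\<lambda>(i, j). Q t (e j) (e i)))"
  have eA: "e i \<in> A" if "i < ?n" for i using e that by (auto simp: bij_betw_def)
  have "cpolyf ?D"
  proof -
    have "?D t = (\<Sum>p\<in>{p. p permutes {0..<?n}}. signof p * (\<Prod>i=0..<?n. Q t (e (p i)) (e i)))" for t
      unfolding det_def by (auto intro!: sum.cong prod.cong dest: permutes_in_image)
    moreover have "cpolyf (\<lambda>t. \<Sum>p\<in>{p. p permutes {0..<?n}}. signof p * (\<Prod>i=0..<?n. Q t (e (p i)) (e i)))"
      by (intro polyf_intros assms(2) eA) (auto dest: permutes_in_image)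
    ultimately show ?thesis by simp
  qed
  moreover have "?D t0 \<noteq> 0" using assms(3) nonsing_iff_det[OF e] by blast
  ultimately have "finite {t. ?D t = 0}" by (rule cpolyf_finite_zeros)
  then show ?thesis using nonsing_iff_det[OF e] by simp
qed

text \<open>There is one row more than there are columns. A zero column at m makes the system
  square, and it is singular because its transpose kills the unit vector at m.\<close>

lemma exists_dependency:
  assumes "finite K" "m \<notin> K"
  obtains v :: "'b \<Rightarrow> complex" and b where "b \<in> insert m K" "v b \<noteq> 0"
    "\<And>c. c \<in> K \<Longrightarrow> (\<Sum>b\<in>insert m K. v b * q b c) = 0"
proof -
  let ?A = "insert m K"
  let ?Q = "\<lambda>b c. if c = m then 0 else q b c"
  have "\<not> nonsing ?A (\<lambda>b c. ?Q c b)"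
    unfolding nonsing_def
  proof (intro notI)
    assume *: "\<forall>v. (\<forall>c\<in>?A. (\<Sum>b\<in>?A. v b * ?Q c b) = 0) \<longrightarrow> (\<forall>b\<in>?A. v b = 0)"
    have "(\<Sum>b\<in>?A. (if b = m then 1 else 0) * ?Q c b) = 0" for c
      by (rule sum.neutral) auto
    then show False using *[rule_format, of "\<lambda>b. if b = m then 1 else 0" m] by auto
  qed
  then have "\<not> nonsing ?A ?Q" using nonsing_transpose[of ?A ?Q] assms(1) by simp
  then obtain v b where v: "\<forall>c\<in>?A. (\<Sum>b\<in>?A. v b * ?Q b c) = 0" "b \<in> ?A" "v b \<noteq> 0"
    unfolding nonsing_def by blast
  have "(\<Sum>b\<in>?A. v b * q b c) = 0" if "c \<in> K" for c
  proof -
    have "c \<noteq> m" using that assms(2) by auto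
    moreover have "(\<Sum>b\<in>?A. v b * ?Q b c) = 0" using v(1) that by blast
    ultimately show ?thesis by (simp only: if_False)
  qed
  then show ?thesis using that v by blast
qed

text \<open>The indices 1 to r are shifted to library matrices, which start at 0; a nonzero
  determinant gives an inverse whose entries are shifted back.\<close>

lemma nonsing_imp_invertible:
  assumes "nonsing {1..r} g"
  shows "Defs.invertible_mat r g"
proof -
  have bij: "bij_betw Suc {0..<r} {1..r}" by (simp add: bij_betw_def image_Suc_atLeastLessThan atLeastLessThanSuc_atLeastAtMost)
  let ?M = "mat r r (\<lambda>(i, j). g (Suc i) (Suc j))"
  have "nonsing {1..r} (\<lambda>b c. g c b)" using assms nonsing_transpose by blast
  then have "det ?M \<noteq> 0" using nonsing_iff_det[OF bij, of "\<lambda>b c. g c b"] by simp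
  then obtain B where B: "B \<in> carrier_mat r r" "?M * B = 1\<^sub>m r"
    using det_non_zero_imp_unit[of ?M r, where b = "()"] unfolding Units_def ring_mat_def by auto
  let ?h = "\<lambda>i j. B $$ (i - 1, j - 1)"
  have "(\<Sum>k=1..r. g i k * ?h k j) = id_mat i j" if "i \<in> {1..r}" "j \<in> {1..r}" for i j
  proof -
    have "(\<Sum>k=1..r. g i k * ?h k j) = (\<Sum>k=0..<r. g i (Suc k) * ?h (Suc k) j)"
      by (rule sum.reindex_bij_betw[OF bij, symmetric])
    also have "\<dots> = (?M * B) $$ (i - 1, j - 1)"
      using that B(1) by (auto simp: scalar_prod_def intro!: sum.cong)
    also have "\<dots> = id_mat i j" using that unfolding B(2) by auto
    finally show ?thesis .
  qed
  then show ?thesis unfolding Defs.invertible_mat_def by (intro exI[of _ ?h] ballI)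
qed

section \<open>Lines of matrices through the identity\<close>

lemma sum_id_mat: "finite A \<Longrightarrow> c \<in> A \<Longrightarrow> (\<Sum>b\<in>A. v b * (if b = c then 1 else 0)) = (v c :: complex)"
  by (simp add: sum.remove[of A c])

lemma nonsing_id_mat: "nonsing {1..r} id_mat"
  unfolding nonsing_def using sum_id_mat[of "{1..r}"] by auto

text \<open>The line passes through the identity at t = 0 and through h at t = 1. An open condition
  that holds at one of its points fails for only finitely many t, so several such conditions can be
  met at once.\<close>

definition line :: "(nat \<Rightarrow> nat \<Rightarrow> complex) \<Rightarrow> complex \<Rightarrow> nat \<Rightarrow> nat \<Rightarrow> complex" where
  "line h t i j = id_mat i j + t * (h i j - id_mat i j)"

lemma line_0: "line h 0 = id_mat"
  by (intro ext) (simp add: line_def)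

lemma line_1: "line h 1 = h"
  by (intro ext) (simp add: line_def)

lemma line_invertible: "finite {t. \<not> Defs.invertible_mat r (line h t)}"
proof (rule finite_subset)
  show "{t. \<not> Defs.invertible_mat r (line h t)} \<subseteq> {t. \<not> nonsing {1..r} (line h t)}"
    using nonsing_imp_invertible by blast
  show "finite {t. \<not> nonsing {1..r} (line h t)}"
  proof (rule nonsing_cofinite[of _ _ 0])
    show "nonsing {1..r} (line h 0)" using nonsing_id_mat[of r] line_0 by metis
    show "cpolyf (\<lambda>t. line h t b c)" for b c
      unfolding line_def by (intro polyf_intros)
  qed simp
qed

lemma eval_entry_cong:
  assumes "entry_poly r F" "\<And>i j. i \<in> {1..r} \<Longrightarrow> j \<in> {1..r} \<Longrightarrow> g i j = h i j"
  shows "eval_entry F g = eval_entry F h"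
  unfolding eval_entry_def
proof (intro sum.cong arg_cong2[where f = "(*)"] prod.cong refl)
  fix m ij assume "m \<in> keys F" "ij \<in> keys m"
  then have "ij \<in> {1..r} \<times> {1..r}" using assms(1) by (auto simp: entry_poly_def)
  then show "g (fst ij) (snd ij) ^ lookup m ij = h (fst ij) (snd ij) ^ lookup m ij"
    using assms(2)[of "fst ij" "snd ij"] by (auto simp: mem_Times_iff)
qed

lemma eval_entry_line:
  assumes "entry_poly r F" "eval_entry F g \<noteq> 0"
  shows "finite {t. eval_entry F (mmul r (line h t) g) = 0}"
proof (rule cpolyf_finite_zeros[of _ 0])
  show "cpolyf (\<lambda>t. eval_entry F (mmul r (line h t) g))"
    unfolding eval_entry_def mmul_def line_def by (intro polyf_intros)
  \<comment> \<open>The product with the identity agrees with g only at indices from 1 to r, which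
    are the only entries that \<open>F\<close> involves.\<close>
  have "eval_entry F (mmul r (line h 0) g) = eval_entry F g"
  proof (rule eval_entry_cong[OF assms(1)])
    fix i j assume "i \<in> {1..r}" "j \<in> {1..r}"
    have "mmul r (line h 0) g i j = (\<Sum>k=1..r. g k j * (if k = i then 1 else 0))"
      unfolding mmul_def line_def by (intro sum.cong) auto
    then show "mmul r (line h 0) g i j = g i j" using \<open>i \<in> {1..r}\<close> sum_id_mat[of "{1..r}" i] by simp
  qed
  then show "eval_entry F (mmul r (line h 0) g) \<noteq> 0" using assms(2) by simp
qed

text \<open>Kronecker substitution: sending the entry with code \<open>k\<close> to \<open>t ^ (N ^ k)\<close>, for \<open>N\<close>
  exceeding all exponents, maps distinct monomials to distinct powers of \<open>t\<close>.\<close>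

lemma exists_eval_entry_nonzero:
  assumes "F \<noteq> 0"
  obtains g where "eval_entry F g \<noteq> 0"
proof -
  let ?X = "\<Union>m\<in>keys F. keys m"
  define N where "N = Suc (\<Sum>m\<in>keys F. \<Sum>ij\<in>keys m. lookup m ij)"
  define R where "R = (\<Sum>ij\<in>?X. prod_encode ij)"
  have fin: "finite ?X" by simp
  have bound: "lookup m ij < N" if "m \<in> keys F" for m ij
  proof (cases "ij \<in> keys m")
    case True
    have "lookup m ij \<le> (\<Sum>ij\<in>keys m. lookup m ij)" using True by (intro member_le_sum) auto
    also have "\<dots> \<le> (\<Sum>m\<in>keys F. \<Sum>ij\<in>keys m. lookup m ij)"
      using that by (intro member_le_sum) auto
    finally show ?thesis by (simp add: N_def)
  qed (simp add: N_def in_keys_iff)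
  have code: "prod_encode ij \<le> R" if "m \<in> keys F" "ij \<in> keys m" for m ij
    unfolding R_def using that fin by (intro member_le_sum) auto
  define E where "E m = (\<Sum>ij\<in>keys m. lookup m ij * N ^ prod_encode ij)" for m :: "nat \<times> nat \<Rightarrow>\<^sub>0 nat"
  \<comment> \<open>Summing over all positions up to \<open>R\<close> turns every \<open>E m\<close>
    into a base-N numeral of common length, so that numerals can be compared digit by digit.\<close>
  have E: "E m = (\<Sum>k\<le>R. lookup m (prod_decode k) * N ^ k)" if "m \<in> keys F" for m
  proof -
    have "E m = (\<Sum>k\<in>prod_encode ` keys m. lookup m (prod_decode k) * N ^ k)"
      unfolding E_def by (subst sum.reindex) (auto simp: inj_on_def)
    also have "\<dots> = (\<Sum>k\<le>R. lookup m (prod_decode k) * N ^ k)"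
    proof (rule sum.mono_neutral_left)
      show "\<forall>k\<in>{..R} - prod_encode ` keys m. lookup m (prod_decode k) * N ^ k = 0"
      proof
        fix k assume "k \<in> {..R} - prod_encode ` keys m"
        then have "prod_decode k \<notin> keys m" by (metis DiffD2 imageI prod_decode_inverse)
        then show "lookup m (prod_decode k) * N ^ k = 0" by (simp add: in_keys_iff)
      qed
    qed (use code[OF that] in auto)
    finally show ?thesis .
  qed
  have inj: "m = m'" if mm: "m \<in> keys F" "m' \<in> keys F" "E m = E m'" for m m'
  proof (rule ccontr)
    assume "m \<noteq> m'"
    let ?D = "{k. lookup m (prod_decode k) \<noteq> lookup m' (prod_decode k)}"
    have sub: "?D \<subseteq> {..R}"
    proof
      fix k assume "k \<in> ?D"
      then have "prod_decode k \<in> keys m \<or> prod_decode k \<in> keys m'" by (auto simp: in_keys_iff)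
      then show "k \<in> {..R}" using code[of m "prod_decode k"] code[of m' "prod_decode k"] mm by auto
    qed
    then have fin: "finite ?D" by (rule finite_subset) simp
    obtain ij where "lookup m ij \<noteq> lookup m' ij" using \<open>m \<noteq> m'\<close> by (meson poly_mapping_eqI)
    then have "prod_encode ij \<in> ?D" by simp
    then have ne: "?D \<noteq> {}" by blast
    define k where "k = Max ?D"
    have k: "k \<in> ?D" unfolding k_def by (rule Max_in[OF fin ne])
    have kR: "k \<le> R" using k sub by blast
    have gt: "lookup m (prod_decode i) = lookup m' (prod_decode i)" if "k < i" for i
      using Max_ge[OF fin, of i] that by (auto simp: k_def)
    from k consider "lookup m (prod_decode k) < lookup m' (prod_decode k)"
      | "lookup m' (prod_decode k) < lookup m (prod_decode k)" by fastforce
    then show False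
    proof cases
      case 1
      then have "E m < E m'" unfolding E[OF mm(1)] E[OF mm(2)]
        by (intro positional_less[of _ _ k]) (use bound mm gt kR in auto)
      then show ?thesis using mm by simp
    next
      case 2
      then have "E m' < E m" unfolding E[OF mm(1)] E[OF mm(2)]
        by (intro positional_less[of _ _ k]) (use bound mm gt kR in auto)
      then show ?thesis using mm by simp
    qed
  qed
  \<comment> \<open>This is the result of the substitution as a polynomial in t. As \<open>E\<close>
    is injective on the monomials of \<open>F\<close>, no coefficients merge and q is
    nonzero.\<close>
  define q where "q = (\<Sum>m\<in>keys F. monom (lookup F m) (E m))"
  obtain m0 where m0: "m0 \<in> keys F" using assms by (meson all_not_in_conv keys_eq_empty)
  have "coeff q (E m0) = (\<Sum>m\<in>keys F. if m = m0 then lookup F m else 0)"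
    unfolding q_def coeff_sum using inj m0 by (intro sum.cong) auto
  also have "\<dots> = lookup F m0" using m0 by simp
  finally have "q \<noteq> 0" using m0 by (auto simp: in_keys_iff)
  then have "finite {t. poly q t = 0}" by (rule poly_roots_finite)
  then obtain t where t: "poly q t \<noteq> 0" by (rule finite_bad_ex[of _ "{}"]) auto
  have "eval_entry F (\<lambda>i j. t ^ (N ^ prod_encode (i, j))) = poly q t"
    unfolding eval_entry_def q_def E_def
    by (simp add: poly_sum poly_monom power_sum power_mult[symmetric] mult.commute)
  then show ?thesis using t that by metis
qed

text \<open>On the line from the identity to a point where \<open>F\<close> is nonzero, each of the
  two conditions excludes only finitely many parameters.\<close>

lemma exists_generic_invertible:
  assumes "F \<noteq> 0" "entry_poly r F"
  obtains g where "Defs.invertible_mat r g" "eval_entry F g \<noteq> 0"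
proof -
  obtain g0 where g0: "eval_entry F g0 \<noteq> 0" using exists_eval_entry_nonzero[OF assms(1)] .
  have "finite {t. eval_entry F (line g0 t) = 0}"
  proof (rule cpolyf_finite_zeros[of _ 1])
    show "cpolyf (\<lambda>t. eval_entry F (line g0 t))"
      unfolding eval_entry_def line_def by (intro polyf_intros)
  qed (simp add: line_1 g0)
  then obtain t where "eval_entry F (line g0 t) \<noteq> 0" "Defs.invertible_mat r (line g0 t)"
    using finite_bad_ex[OF _ line_invertible[of r g0]] by blast
  then show ?thesis using that by blast
qed

section \<open>Generic initial ideals are strongly stable\<close>

text \<open>The elementary unipotent matrix whose substitution sends x_j to x_i + x_j and fixes the
  other variables.\<close>

definition elem :: "nat \<Rightarrow> nat \<Rightarrow> nat \<Rightarrow> nat \<Rightarrow> complex" where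
  "elem i j k l = (if k = l \<or> k = i \<and> l = j then 1 else 0)"

lemma monsub_cong: "(\<And>j. j \<in> keys m \<Longrightarrow> \<sigma> j = \<tau> j) \<Longrightarrow> monsub \<sigma> m = monsub \<tau> m"
  unfolding monsub_def by (rule prod.cong) auto

lemma lin_subst_elem:
  assumes "1 \<le> l" "l \<le> r" "1 \<le> i" "i < j" "j \<le> r"
  shows "lin_subst r (elem i j) l = (if l = j then xmon (var i) + xmon (var j) else xmon (var l))"
proof -
  have "lin_subst r (elem i j) l =
      (\<Sum>k=1..r. (if k = l then xmon (var l) else 0) + (if k = i then if l = j then xmon (var i) else 0 else 0))"
    unfolding lin_subst_def by (intro sum.cong) (use assms in \<open>auto simp: elem_def xmon_def\<close>)
  then show ?thesis using assms by (simp add: sum.distrib add.commute)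
qed

text \<open>Only the factor x_j ^ a of b is changed, and it is expanded by the binomial
  theorem.\<close>

lemma elem_monsub_eq:
  assumes ij: "1 \<le> i" "i < j" "j \<le> r" and b: "mon_in r b" and a: "lookup b j = a"
  obtains b' where "b = b' + single j a" "lookup b' j = 0"
    "monsub (lin_subst r (elem i j)) b =
      (\<Sum>k\<le>a. single (b' + single i k + single j (a - k)) (of_nat (a choose k)))"
proof
  let ?b' = "b - single j a"
  let ?\<sigma> = "lin_subst r (elem i j)"
  have lk: "lookup ?b' l = (if l = j then 0 else lookup b l)" for l
    by (simp add: lookup_minus a lookup_single when_def)
  show b': "b = ?b' + single j a"
    by (rule poly_mapping_eqI) (use a in \<open>auto simp: lookup_add lk lookup_single when_def\<close>)
  show "lookup ?b' j = 0" by (simp add: lk)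
  have "monsub ?\<sigma> ?b' = monsub (\<lambda>l. xmon (var l)) ?b'"
  proof (rule monsub_cong)
    fix l assume "l \<in> keys ?b'"
    then have "l \<noteq> j" "l \<in> keys b" by (auto simp: in_keys_iff lk split: if_splits)
    then show "?\<sigma> l = xmon (var l)"
      using b ij by (subst lin_subst_elem) (auto simp: mon_in_def)
  qed
  moreover have "monsub ?\<sigma> (single j a) = ?\<sigma> j ^ a"
    by (simp add: monsub_def)
  ultimately have "monsub ?\<sigma> b = xmon ?b' * (xmon (var i) + xmon (var j)) ^ a"
    by (subst b') (use ij in \<open>simp add: monsub_add monsub_xmon_var lin_subst_elem\<close>)
  also have "\<dots> = (\<Sum>k\<le>a. single (?b' + single i k + single j (a - k)) (of_nat (a choose k)))"
    unfolding binomial_ring sum_distrib_left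
  proof (rule sum.cong)
    fix k
    have "of_nat (a choose k) = (single 0 (of_nat (a choose k)) :: cpoly)"
      by (simp only: single_of_nat)
    then show "xmon ?b' * (of_nat (a choose k) * xmon (var i) ^ k * xmon (var j) ^ (a - k)) =
        single (?b' + single i k + single j (a - k)) (of_nat (a choose k))"
      by (simp only: xmon_var_power) (simp add: xmon_def mult_single add.assoc del: single_of_nat)
  qed simp
  finally show "monsub ?\<sigma> b = (\<Sum>k\<le>a. single (?b' + single i k + single j (a - k)) (of_nat (a choose k)))" .
qed

text \<open>Each exchange of x_j for x_i makes the monomial larger, so the binomial terms increase
  with k. Thus b is the trailing monomial; if x_j divides b, the next one is x_i b / x_j, and its
  coefficient is the exponent of x_j in b, nonzero in characteristic zero.\<close>

lemma elem_monsub: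
  assumes ij: "1 \<le> i" "i < j" "j \<le> r" and b: "mon_in r b"
  shows "lookup (monsub (lin_subst r (elem i j)) b) b = 1"
    and "c \<in> keys (monsub (lin_subst r (elem i j)) b) \<Longrightarrow> c \<noteq> b \<Longrightarrow> revlex_less b c"
    and "b = u + var j \<Longrightarrow> lookup (monsub (lin_subst r (elem i j)) b) (u + var i) \<noteq> 0"
    and "b = u + var j \<Longrightarrow> c \<in> keys (monsub (lin_subst r (elem i j)) b) \<Longrightarrow> c \<noteq> b \<Longrightarrow>
      c \<noteq> u + var i \<Longrightarrow> revlex_less (u + var i) c"
proof -
  define a where "a = lookup b j"
  obtain b' where b': "b = b' + single j a" "lookup b' j = 0"
    and eq: "monsub (lin_subst r (elem i j)) b =
      (\<Sum>k\<le>a. single (b' + single i k + single j (a - k)) (of_nat (a choose k)))"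
    by (rule elem_monsub_eq[OF ij b a_def[symmetric]])
  define t where "t k = b' + single i k + single j (a - k)" for k
  have lt: "lookup (t k) l = lookup b' l + (if l = i then k else 0) + (if l = j then a - k else 0)" for k l
    by (simp add: t_def lookup_add lookup_single when_def)
  have deg_single: "mdeg (single l k) = k" for l k
    by (simp add: mdeg_def)
  have mdeg_t: "mdeg (t k) = mdeg b' + a" if "k \<le> a" for k
    using that by (simp add: t_def mdeg_add deg_single)
  have less: "revlex_less (t k) (t l)" if "k < l" "l \<le> a" for k l
    using that mdeg_t ij b'(2) by (auto simp: revlex_less_iff lt intro!: exI[of _ j])
  have inj: "t k = t l \<longleftrightarrow> k = l" if "k \<le> a" "l \<le> a" for k l
    using less[of k l] less[of l k] that by (cases k l rule: linorder_cases) auto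
  have t0: "t 0 = b" by (simp add: t_def b'(1))
  have lookup_t: "lookup (monsub (lin_subst r (elem i j)) b) (t k) = of_nat (a choose k)" if "k \<le> a" for k
  proof -
    have "lookup (monsub (lin_subst r (elem i j)) b) (t k) = (\<Sum>l\<le>a. if l = k then of_nat (a choose l) else 0)"
      unfolding eq t_def[symmetric] lookup_sum
      by (intro sum.cong) (use inj that in \<open>auto simp: lookup_single when_def\<close>)
    then show ?thesis using that by simp
  qed
  show "lookup (monsub (lin_subst r (elem i j)) b) b = 1"
    using lookup_t[of 0] by (simp add: t0)
  have keys: "\<exists>k\<le>a. c = t k" if "c \<in> keys (monsub (lin_subst r (elem i j)) b)" for c
    using that keys_sum[of "\<lambda>k. single (t k) (of_nat (a choose k))" "{..a}"]
    unfolding eq t_def[symmetric] by (auto split: if_splits)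
  show "revlex_less b c" if "c \<in> keys (monsub (lin_subst r (elem i j)) b)" "c \<noteq> b"
    using keys[OF that(1)] that(2) less[of 0] t0 by (metis neq0_conv)
  assume u: "b = u + var j"
  then have "1 \<le> a" by (simp add: a_def lookup_add lookup_var)
  have t1: "u + var i = t 1"
  proof (rule poly_mapping_eqI)
    fix l
    have "lookup b l = lookup b' l + (if l = j then a else 0)"
      by (subst b'(1)) (simp add: lookup_add lookup_single when_def)
    then show "lookup (u + var i) l = lookup (t 1) l"
      using \<open>1 \<le> a\<close> ij by (auto simp: u lt lookup_add lookup_var)
  qed
  show "lookup (monsub (lin_subst r (elem i j)) b) (u + var i) \<noteq> 0"
    using lookup_t[of 1] \<open>1 \<le> a\<close> by (simp add: t1)
  assume c: "c \<in> keys (monsub (lin_subst r (elem i j)) b)" "c \<noteq> b" "c \<noteq> u + var i"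
  obtain k where k: "k \<le> a" "c = t k" using keys[OF c(1)] by blast
  have "k \<noteq> 0" "k \<noteq> 1" using c k t0 t1 by metis+
  then show "revlex_less (u + var i) c" using less[of 1 k] k t1 by simp
qed

text \<open>A one-parameter diagonal subgroup scaling x_k by s ^ (N ^ k), so that a monomial m is
  scaled by s ^ \<open>wt N m\<close>.\<close>

definition torus :: "nat \<Rightarrow> complex \<Rightarrow> nat \<Rightarrow> nat \<Rightarrow> complex" where
  "torus N s k l = (if k = l then s ^ (N ^ k) else 0)"

lemma const_prod: "(\<Prod>x\<in>A. single 0 (f x) :: cpoly) = single 0 (\<Prod>x\<in>A. f x)"
  by (induction A rule: infinite_finite_induct) (auto simp: mult_single)

lemma monsub_torus:
  assumes "mon_in r m"
  shows "monsub (lin_subst r (torus N s)) m = single m (s ^ wt N m)"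
proof -
  have lin: "lin_subst r (torus N s) l = single 0 (s ^ (N ^ l)) * xmon (var l)" if "l \<in> {1..r}" for l
  proof -
    have "lin_subst r (torus N s) l = (\<Sum>k=1..r. if k = l then single (var l) (s ^ (N ^ l)) else 0)"
      unfolding lin_subst_def torus_def by (intro sum.cong) auto
    then show ?thesis using that single_eq_const_xmon[of "var l"] by simp
  qed
  have "monsub (lin_subst r (torus N s)) m = (\<Prod>l\<in>keys m. (single 0 (s ^ (N ^ l)) * xmon (var l)) ^ lookup m l)"
    unfolding monsub_def using assms lin by (intro prod.cong refl) (auto simp: mon_in_def subset_iff)
  also have "\<dots> = single 0 (\<Prod>l\<in>keys m. (s ^ (N ^ l)) ^ lookup m l) * monsub (\<lambda>l. xmon (var l)) m"
    by (simp add: power_mult_distrib prod.distrib const_power const_prod monsub_def)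
  also have "(\<Prod>l\<in>keys m. (s ^ (N ^ l)) ^ lookup m l) = s ^ wt N m"
    by (simp add: wt_def power_sum power_mult[symmetric] mult.commute)
  finally show ?thesis by (simp add: monsub_xmon_var single_eq_const_xmon[symmetric])
qed

lemma subst_mmul_torus:
  assumes "p \<in> polyring r"
  shows "subst (lin_subst r (mmul r g (torus N s))) p =
    (\<Sum>m\<in>keys p. single 0 (lookup p m * s ^ wt N m) * monsub (lin_subst r g) m)"
proof -
  have "subst (lin_subst r (torus N s)) p = (\<Sum>m\<in>keys p. single m (lookup p m * s ^ wt N m))"
    unfolding subst_eq_sum[OF finite_keys order_refl]
    by (intro sum.cong) (use assms in \<open>auto simp: monsub_torus mult_single polyring_def\<close>)
  then show ?thesis
    by (simp add: subst_mmul[OF assms, symmetric] subst_sum subst_single)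
qed

lemma nonsing_scale:
  assumes "nonsing A Q" "\<And>b. b \<in> A \<Longrightarrow> s b \<noteq> 0"
  shows "nonsing A (\<lambda>b c. s b * Q b c)"
  unfolding nonsing_def
proof (intro allI impI)
  fix v assume "\<forall>c\<in>A. (\<Sum>b\<in>A. v b * (s b * Q b c)) = 0"
  then have "\<forall>c\<in>A. (\<Sum>b\<in>A. (v b * s b) * Q b c) = 0" by (simp add: mult.assoc)
  then have "\<forall>b\<in>A. v b * s b = 0"
    using assms(1)[unfolded nonsing_def, THEN spec, of "\<lambda>b. v b * s b"] by blast
  then show "\<forall>b\<in>A. v b = 0" using assms(2) by auto
qed

lemma nonsing_cong:
  "(\<And>b c. b \<in> A \<Longrightarrow> c \<in> A \<Longrightarrow> Q b c = R b c) \<Longrightarrow> nonsing A Q \<longleftrightarrow> nonsing A R"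
  unfolding nonsing_def by (simp cong: sum.cong)

text \<open>The matrix is triangular when rows and columns are ordered by their labels
  \<open>cc\<close>. In a vanishing combination take the row of least label with nonzero
  coefficient: in its own column no other row contributes.\<close>

lemma nonsing_triangular:
  fixes cc :: "'b \<Rightarrow> mon"
  assumes "finite A" "inj_on cc A" "\<And>b. b \<in> A \<Longrightarrow> Q b b \<noteq> 0"
    "\<And>b c. b \<in> A \<Longrightarrow> c \<in> A \<Longrightarrow> revlex_less (cc c) (cc b) \<Longrightarrow> Q b c = 0"
  shows "nonsing A Q"
  unfolding nonsing_def
proof (intro allI impI, rule ccontr)
  fix v assume v: "\<forall>c\<in>A. (\<Sum>b\<in>A. v b * Q b c) = 0" and "\<not> (\<forall>b\<in>A. v b = 0)"
  then have "cc ` {b \<in> A. v b \<noteq> 0} \<noteq> {}" by auto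
  then obtain g where g: "g \<in> cc ` {b \<in> A. v b \<noteq> 0}"
    "\<And>x. x \<in> cc ` {b \<in> A. v b \<noteq> 0} \<Longrightarrow> x \<noteq> g \<Longrightarrow> revlex_less g x"
    using finite_revlex_least[of "cc ` {b \<in> A. v b \<noteq> 0}"] assms(1) by auto
  then obtain c where c: "c \<in> A" "v c \<noteq> 0" "g = cc c" by auto
  have "v b * Q b c = 0" if "b \<in> A - {c}" for b
  proof (cases "v b = 0")
    case False
    have "cc b \<noteq> cc c" using assms(2) that c(1) by (auto simp: inj_on_def)
    then have "revlex_less (cc c) (cc b)" using g(2)[of "cc b"] that False c by auto
    then show ?thesis using assms(4) that c by simp
  qed simp
  then have "(\<Sum>b\<in>A - {c}. v b * Q b c) = 0" by (rule sum.neutral[OF ballI])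
  then have "(\<Sum>b\<in>A. v b * Q b c) = v c * Q c c"
    using assms(1) c(1) by (simp only: sum.remove[of A c]) simp
  then show False using v c assms(3) by simp
qed

text \<open>By \<open>L\<close> all admissible matrices give the same leading monomials. The
  contradiction is an admissible matrix for which |K| + 1 elements stay independent on the monomials
  at least x_i u, where only |K| leading monomials are available.\<close>

lemma generic_leads_stable:
  assumes G: "G \<subseteq> polyring r" "\<And>q. q \<in> G \<Longrightarrow> \<exists>d\<le>n. homog_of_deg d q"
    and F: "entry_poly r F" "Defs.invertible_mat r g0" "eval_entry F g0 \<noteq> 0"
    and L: "\<And>g. Defs.invertible_mat r g \<Longrightarrow> eval_entry F g \<noteq> 0 \<Longrightarrow> leads (act r g (ideal_gen r G)) = L"
    and m: "u + var j \<in> L" and ij: "1 \<le> i" "i < j"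
  shows "u + var i \<in> L"
proof (rule ccontr)
  assume nL: "u + var i \<notin> L"
  define V where "V = act r g0 (ideal_gen r G)"
  have I: "is_ideal r (ideal_gen r G)" by (rule ideal_gen_is_ideal[OF G(1)])
  have Vgen: "V = ideal_gen r (act r g0 G)"
    unfolding V_def by (rule act_ideal_gen[OF G(1) F(2)])
  have V: "homog_ideal r V" unfolding Vgen
    by (rule homog_ideal_gen(1)[of _ _ n]) (use G(2) homog_subst in \<open>fastforce simp: act_def subst_polyring\<close>)+
  then have Vid: "is_ideal r V" and Vpoly: "V \<subseteq> polyring r"
    by (auto simp: homog_ideal_def is_ideal_def)
  have LV: "leads V = L" unfolding V_def by (rule L[OF F(2,3)])
  let ?m = "u + var j" and ?x = "u + var i"
  define d where "d = mdeg ?m"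
  have d: "d = Suc (mdeg u)" by (simp add: d_def mdeg_add)
  have Lr: "mon_in r c" if "c \<in> L" for c using leads_mon_in[OF Vid] LV that by simp
  have jr: "j \<le> r" using Lr[OF m] by simp
  have mx: "revlex_less ?m ?x" using revlex_var[OF ij(2)] by simp
  define T where "T c \<longleftrightarrow> c = ?x \<or> revlex_less ?x c" for c
  define K where "K = {c \<in> L. mdeg c = d \<and> T c}"
  let ?A = "insert ?m K"
  have K: "finite K"
    by (rule finite_subset[OF _ finite_mons[of r d]]) (auto simp: K_def mons_def Lr)
  have mK: "?m \<notin> K" using mx revlex_asym by (auto simp: K_def T_def)
  have xK: "?x \<notin> K" using nL by (auto simp: K_def)
  have AL: "b \<in> L" "mdeg b = d" if "b \<in> ?A" for b
    using that m by (auto simp: K_def d_def)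
  \<comment> \<open>Rows are indexed by \<open>?A\<close>, columns by the labels \<open>cc\<close>.
    Exchanging x_j u for x_i u puts all labels at or above x_i u, and they remain distinct because
    x_i u is not in \<open>K\<close>.\<close>
  define cc where "cc b = (if b = ?m then ?x else b)" for b
  have Tcc: "T (cc b)" if "b \<in> ?A" for b using that by (auto simp: cc_def T_def K_def)
  have inj: "inj_on cc ?A" using xK by (auto simp: inj_on_def cc_def)
  have "\<forall>b\<in>?A. \<exists>f. f \<in> V \<and> homog_of_deg d f \<and> lead_mon f = b \<and> lookup f b = 1 \<and> f \<noteq> 0"
    using leads_homogE[OF V] AL LV by metis
  from bchoice[OF this] obtain f where
    "\<forall>b\<in>?A. f b \<in> V \<and> homog_of_deg d (f b) \<and> lead_mon (f b) = b \<and> lookup (f b) b = 1 \<and> f b \<noteq> 0"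
    by blast
  then have f: "\<And>b. b \<in> ?A \<Longrightarrow> f b \<in> V" "\<And>b. b \<in> ?A \<Longrightarrow> homog_of_deg d (f b)"
    "\<And>b. b \<in> ?A \<Longrightarrow> lead_mon (f b) = b" "\<And>b. b \<in> ?A \<Longrightarrow> lookup (f b) b = 1"
    "\<And>b. b \<in> ?A \<Longrightarrow> f b \<noteq> 0"
    by blast+
  let ?\<gamma> = "lin_subst r (elem i j)"
  define w where "w = wt (Suc d)"
  have wf: "w b < w k" if b: "b \<in> ?A" and "k \<in> keys (f b)" "k \<noteq> b" for b k
  proof -
    have mons: "keys (f b) \<subseteq> mons r d"
      using homog_keys_mons[of "f b" r d] f b Vpoly by blast
    have "b \<in> keys (f b)" using f(4)[OF b] by (simp add: in_keys_iff)
    moreover have "revlex_less k b" using revlex_lead_mon[of "f b" k] f b that by simp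
    ultimately show ?thesis unfolding w_def using that mons by (intro wt_less[of _ _ r]) auto
  qed
  \<comment> \<open>Rescaled coefficients of \<open>elem i j\<close> composed with the torus, applied to \<open>f b\<close>;
    at \<open>s = 0\<close> only the leading monomial \<open>b\<close> of \<open>f b\<close> survives.\<close>
  define Q where "Q s b c = (\<Sum>k\<in>keys (f b). lookup (f b) k * s ^ (w k - w b) * lookup (monsub ?\<gamma> k) (cc c))"
    for s b c
  have Q0: "Q 0 b c = lookup (monsub ?\<gamma> b) (cc c)" if b: "b \<in> ?A" for b c
  proof -
    have bk: "b \<in> keys (f b)" using f(4)[OF b] by (simp add: in_keys_iff)
    have "lookup (f b) k * 0 ^ (w k - w b) * lookup (monsub ?\<gamma> k) (cc c) = 0"
      if "k \<in> keys (f b) - {b}" for k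
      using wf[OF b, of k] that by simp
    then have "(\<Sum>k\<in>keys (f b) - {b}. lookup (f b) k * 0 ^ (w k - w b) * lookup (monsub ?\<gamma> k) (cc c)) = 0"
      by (rule sum.neutral[OF ballI])
    \<comment> \<open>For the leading term the exponent is 0, and 0 ^ 0 = 1.\<close>
    then have "Q 0 b c = lookup (f b) b * 0 ^ (w b - w b) * lookup (monsub ?\<gamma> b) (cc c)"
      unfolding Q_def using bk by (simp only: sum.remove[of _ b] finite_keys) simp
    then show ?thesis using f(4)[OF b] by simp
  qed
  note el = elem_monsub[OF ij jr]
  \<comment> \<open>For b in \<open>K\<close> the image of b has trailing monomial b. The image of
    x_j u has x_i u as its second smallest monomial, and x_j u itself lies below all labels. So the
    matrix is triangular.\<close>
  have "nonsing ?A (Q 0)"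
  proof (rule nonsing_triangular[OF _ inj])
    show "finite ?A" using K by simp
    show "Q 0 b b \<noteq> 0" if b: "b \<in> ?A" for b
      using el(1)[OF Lr[OF AL(1)[OF b]]] el(3)[OF Lr[OF AL(1)[OF b]]] Q0[OF b, of b]
      by (auto simp: cc_def)
    fix b c assume b: "b \<in> ?A" and c: "c \<in> ?A" and less: "revlex_less (cc c) (cc b)"
    have br: "mon_in r b" using Lr AL b by blast
    have "cc c \<notin> keys (monsub ?\<gamma> b)"
    proof
      assume k: "cc c \<in> keys (monsub ?\<gamma> b)"
      show False
      proof (cases "b = ?m")
        case True
        then have "revlex_less (cc c) ?x" using less by (simp add: cc_def)
        then show False using Tcc[OF c] revlex_asym by (auto simp: T_def)
      next
        case False
        then have "revlex_less (cc c) b" using less by (simp add: cc_def)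
        then show False using el(2)[OF br k] revlex_asym revlex_irrefl by metis
      qed
    qed
    then show "Q 0 b c = 0" unfolding Q0[OF b] by (simp add: in_keys_iff)
  qed
  moreover have "cpolyf (\<lambda>s. Q s b c)" for b c
    unfolding Q_def by (intro polyf_intros)
  ultimately have "finite {s. \<not> nonsing ?A (Q s)}"
    using K by (intro nonsing_cofinite[of _ _ 0]) auto
  then obtain s where s: "nonsing ?A (Q s)" "s \<noteq> 0"
    using finite_bad_ex[of "{s. \<not> nonsing ?A (Q s)}" "{0}"] by auto
  define h1 where "h1 = mmul r (elem i j) (torus (Suc d) s)"
  define R where "R t b c = lookup (subst (lin_subst r (line h1 t)) (f b)) (cc c)" for t b c
  have R1: "R 1 b c = s ^ w b * Q s b c" if b: "b \<in> ?A" for b c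
  proof -
    have "R 1 b c = (\<Sum>k\<in>keys (f b). lookup (f b) k * s ^ w k * lookup (monsub ?\<gamma> k) (cc c))"
      using f(1)[OF b] Vpoly
      by (auto simp: R_def line_1 h1_def subst_mmul_torus lookup_sum w_def)
    also have "\<dots> = s ^ w b * Q s b c"
      unfolding Q_def sum_distrib_left
    proof (rule sum.cong)
      fix k assume k: "k \<in> keys (f b)"
      \<comment> \<open>This keeps the natural-number subtraction in the exponent from
        truncating.\<close>
      have "w b \<le> w k" using wf[OF b k] by (cases "k = b") auto
      then have "s ^ w k = s ^ w b * s ^ (w k - w b)" by (simp add: power_add[symmetric])
      then show "lookup (f b) k * s ^ w k * lookup (monsub ?\<gamma> k) (cc c) =
          s ^ w b * (lookup (f b) k * s ^ (w k - w b) * lookup (monsub ?\<gamma> k) (cc c))" by simp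
    qed simp
    finally show ?thesis .
  qed
  have "nonsing ?A (R 1) \<longleftrightarrow> nonsing ?A (\<lambda>b c. s ^ w b * Q s b c)"
    by (rule nonsing_cong) (rule R1)
  then have "nonsing ?A (R 1)" using nonsing_scale[OF s(1), of "\<lambda>b. s ^ w b"] s(2) by simp
  moreover have "cpolyf (\<lambda>t. R t b c)" for b c
    unfolding R_def line_def by (rule polyf_subst_line)
  ultimately have fin: "finite {t. \<not> nonsing ?A (R t)}"
    using K by (intro nonsing_cofinite[of _ _ 1]) auto
  \<comment> \<open>Nonsingularity is known at t = 1, invertibility and nonvanishing of
    \<open>F\<close> at t = 0; some t satisfies all three.\<close>
  have "finite ({t. \<not> nonsing ?A (R t)} \<union> {t. \<not> Defs.invertible_mat r (line h1 t)})"
    using fin line_invertible by simp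
  then obtain t where t: "t \<notin> {t. \<not> nonsing ?A (R t)} \<union> {t. \<not> Defs.invertible_mat r (line h1 t)}"
      "t \<notin> {t. eval_entry F (mmul r (line h1 t) g0) = 0}"
    using finite_bad_ex[OF _ eval_entry_line[OF F(1,3)]] by metis
  define h where "h = line h1 t"
  have R: "nonsing ?A (R t)" and h: "Defs.invertible_mat r h" "eval_entry F (mmul r h g0) \<noteq> 0"
    using t by (auto simp: h_def)
  define W where "W = act r h V"
  have "W = act r (mmul r h g0) (ideal_gen r G)"
    unfolding W_def V_def using I by (intro act_act) (simp add: is_ideal_def)
  then have LW: "leads W = L" using L[OF invertible_mmul[OF h(1) F(2)] h(2)] by simp
  have W: "is_ideal r W" unfolding W_def by (rule act_is_ideal[OF Vid h(1)])
  let ?w = "\<lambda>b. subst (lin_subst r h) (f b)"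
  \<comment> \<open>The |K| + 1 transformed elements have a nontrivial combination whose
    coefficients on \<open>K\<close> vanish.\<close>
  obtain v b0 where v: "b0 \<in> ?A" "v b0 \<noteq> 0" "\<And>c. c \<in> K \<Longrightarrow> (\<Sum>b\<in>?A. v b * lookup (?w b) c) = 0"
    using exists_dependency[OF K mK, where q = "\<lambda>b c. lookup (?w b) c"] by blast
  define z where "z = (\<Sum>b\<in>?A. single 0 (v b) * ?w b)"
  have lz: "lookup z c = (\<Sum>b\<in>?A. v b * lookup (?w b) c)" for c
    unfolding z_def lookup_sum by simp
  have zW: "z \<in> W" unfolding z_def
    by (intro cpoly.subspace_sum[OF ideal_subspace[OF W]] cpoly.subspace_scale[OF ideal_subspace[OF W]])
       (use f(1) in \<open>auto simp: W_def act_def\<close>)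
  have zd: "homog_of_deg d z" unfolding z_def
    by (intro homog_sum homog_const_mult homog_subst f(2))
  \<comment> \<open>If z had a monomial at or above x_i u, its leading monomial would lie in
    \<open>L\<close> and at or above x_i u too, hence in \<open>K\<close>, where z has coefficient
    0.\<close>
  have zT: "lookup z c = 0" if "T c" for c
  proof (rule ccontr)
    assume "lookup z c \<noteq> 0"
    then have c: "c \<in> keys z" and z0: "z \<noteq> 0" by (auto simp: in_keys_iff)
    have lead: "lead_mon z \<in> keys z" by (rule lead_mon_in_keys[OF z0])
    have "T (lead_mon z)"
      using revlex_lead_mon[OF z0 c] that revlex_trans unfolding T_def by metis
    moreover have "lead_mon z \<in> L" using zW z0 LW by (auto simp: leads_def)
    moreover have "mdeg (lead_mon z) = d" using zd lead by (simp add: homog_of_deg_def)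
    ultimately have "lead_mon z \<in> K" by (simp add: K_def)
    then have "lookup z (lead_mon z) = 0" using v(3) by (simp add: lz)
    then show False using lead by (simp add: in_keys_iff)
  qed
  \<comment> \<open>All labels lie at or above x_i u, so v is a relation between the rows of the
    nonsingular matrix \<open>R t\<close>.\<close>
  have "(\<Sum>b\<in>?A. v b * R t b c) = 0" if "c \<in> ?A" for c
    using zT[OF Tcc[OF that]] by (simp only: lz R_def h_def)
  then have "\<forall>b\<in>?A. v b = 0" using R unfolding nonsing_def by blast
  then show False using v(1,2) by blast
qed

section \<open>New generators in degree \<open>n + 1\<close>\<close>

text \<open>Among the vectors used with nonzero coefficient, the largest leading monomial occurs in
  only one and cannot cancel.\<close>

lemma lead_mon_in_span:
  assumes h: "h \<in> cpoly.span B" "h \<noteq> 0" and inj: "inj_on lead_mon B" and B0: "0 \<notin> B"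
  shows "lead_mon h \<in> lead_mon ` B"
proof -
  obtain t c where t: "finite t" "t \<subseteq> B" and hsum: "h = (\<Sum>b\<in>t. single 0 (c b) * b)"
    using h(1) unfolding cpoly.span_explicit by auto
  let ?S = "{b \<in> t. c b \<noteq> 0}"
  have lh: "lookup h k = (\<Sum>b\<in>t. c b * lookup b k)" for k
    unfolding hsum lookup_sum by simp
  have "?S \<noteq> {}"
  proof
    assume "?S = {}"
    then have "\<And>b. b \<in> t \<Longrightarrow> single 0 (c b) * b = 0" by auto
    then show False using h(2) unfolding hsum by (auto intro: sum.neutral)
  qed
  then obtain g where g: "g \<in> lead_mon ` ?S"
      "\<And>x. x \<in> lead_mon ` ?S \<Longrightarrow> x \<noteq> g \<Longrightarrow> revlex_less x g"
    using finite_revlex_greatest[of "lead_mon ` ?S"] t(1) by auto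
  then obtain b where b: "b \<in> t" "c b \<noteq> 0" "g = lead_mon b" by auto
  have le: "k = lead_mon s \<or> revlex_less k (lead_mon s)" if "s \<in> t" "k \<in> keys s" for s k
    using revlex_lead_mon[of s k] that by fastforce
  have below: "k = g \<or> revlex_less k g" if s: "s \<in> ?S" and k: "k \<in> keys s" for s k
  proof -
    have "lead_mon s = g \<or> revlex_less (lead_mon s) g" using g(2)[of "lead_mon s"] s by blast
    moreover have "k = lead_mon s \<or> revlex_less k (lead_mon s)" using le s k by blast
    ultimately show ?thesis using revlex_trans by metis
  qed
  have "c s * lookup s g = 0" if "s \<in> t - {b}" for s
  proof (rule ccontr)
    assume "c s * lookup s g \<noteq> 0"
    then have s: "s \<in> ?S" "g \<in> keys s" using that by (auto simp: in_keys_iff)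
    have "lead_mon s \<noteq> g" using inj that b t(2) by (auto simp: inj_on_def)
    then have "revlex_less (lead_mon s) g" using g(2)[of "lead_mon s"] s by blast
    moreover have "g = lead_mon s \<or> revlex_less g (lead_mon s)" using le s by blast
    ultimately show False using \<open>lead_mon s \<noteq> g\<close> revlex_asym by blast
  qed
  then have "(\<Sum>s\<in>t - {b}. c s * lookup s g) = 0" by (rule sum.neutral[OF ballI])
  then have "lookup h g = c b * lookup b g"
    unfolding lh using t(1) b(1) by (simp only: sum.remove[of t b]) simp
  moreover have "lookup b g \<noteq> 0"
    using lead_mon_in_keys[of b] b t B0 by (auto simp: in_keys_iff)
  ultimately have gh: "g \<in> keys h" using b by (simp add: in_keys_iff)
  have "lead_mon h = g"
  proof (rule lead_mon_eqI[OF gh])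
    fix k assume "k \<in> keys h" "k \<noteq> g"
    then have "(\<Sum>s\<in>t. c s * lookup s k) \<noteq> 0" by (simp add: in_keys_iff lh)
    then obtain s where "s \<in> t" "c s * lookup s k \<noteq> 0" by (meson sum.neutral)
    then show "revlex_less k g" using below[of s k] \<open>k \<noteq> g\<close> by (auto simp: in_keys_iff)
  qed
  then show ?thesis using b t by auto
qed

lemma span_mult_left:
  assumes "q \<in> cpoly.span S" "\<And>s. s \<in> S \<Longrightarrow> x * s \<in> cpoly.span T"
  shows "x * q \<in> cpoly.span T"
proof -
  have "cpoly.subspace {q. x * q \<in> cpoly.span T}"
    unfolding cpoly.subspace_def
    by (auto simp: distrib_left cpoly.span_zero cpoly.span_add mult.left_commute[of x] cpoly.span_scale)
  then have "cpoly.span S \<subseteq> {q. x * q \<in> cpoly.span T}"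
    by (intro cpoly.span_minimal) (use assms(2) in auto)
  then show ?thesis using assms(1) by blast
qed

text \<open>Repeated subtraction of leading terms. The bound on the indices m is kept because the
  later reduction is an induction on leading monomials.\<close>

lemma span_by_leads:
  assumes V: "is_ideal r V"
    and f: "\<And>m. m \<in> leads V \<Longrightarrow> mdeg m = n \<Longrightarrow> f m \<in> V \<and> homog_of_deg n (f m) \<and> f m \<noteq> 0 \<and> lead_mon (f m) = m"
    and q: "q \<in> V" "homog_of_deg n q" "q \<noteq> 0"
  shows "q \<in> cpoly.span {f m | m. m \<in> leads V \<and> mdeg m = n \<and> (m = lead_mon q \<or> revlex_less m (lead_mon q))}"
proof -
  let ?S = "\<lambda>w. {f m | m. m \<in> leads V \<and> mdeg m = n \<and> (m = w \<or> revlex_less m w)}"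
  have keys_mons: "keys p \<subseteq> mons r n" if "p \<in> V" "homog_of_deg n p" for p
    using V that homog_keys_mons[of p r n] by (auto simp: is_ideal_def)
  have "lead_mon q \<in> mons r n" using keys_mons[OF q(1,2)] lead_mon_in_keys[OF q(3)] by blast
  \<comment> \<open>The leading monomial is fixed through \<open>q0\<close> as the induction
    variable while q stays universally quantified, so the hypothesis applies to the
    remainder.\<close>
  then have "\<forall>q. q \<in> V \<longrightarrow> homog_of_deg n q \<longrightarrow> q \<noteq> 0 \<longrightarrow> lead_mon q = lead_mon q0 \<longrightarrow> q \<in> cpoly.span (?S (lead_mon q0))"
    if "q0 = q" for q0
    unfolding that
  proof (induction rule: revlex_mons_induct)
    case (less w)
    show ?case
    proof (intro allI impI)
      fix q assume q: "q \<in> V" "homog_of_deg n q" "q \<noteq> 0" "lead_mon q = w"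
      have w: "w \<in> leads V" "mdeg w = n" using q less(1) by (auto simp: leads_def mons_def)
      note fw = f[OF w]
      define c where "c = lookup q w / lookup (f w) w"
      have fw0: "lookup (f w) w \<noteq> 0" using fw lead_mon_in_keys[of "f w"] by (simp add: in_keys_iff)
      define q' where "q' = q - single 0 c * f w"
      have q': "q' \<in> V" "homog_of_deg n q'"
        unfolding q'_def
        using cpoly.subspace_diff[OF ideal_subspace[OF V]] cpoly.subspace_scale[OF ideal_subspace[OF V]]
          cpoly.subspace_diff[OF homog_subspace[of n]] cpoly.subspace_scale[OF homog_subspace[of n]] q fw
        by simp_all
      have q'w: "lookup q' w = 0" using fw0 by (simp add: q'_def lookup_minus c_def)
      have base: "single 0 c * f w \<in> cpoly.span (?S w)"
        using w by (intro cpoly.span_scale cpoly.span_base) blast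
      have "q' \<in> cpoly.span (?S w)"
      proof (cases "q' = 0")
        case True
        then show ?thesis by (simp add: cpoly.span_zero)
      next
        case False
        have lead: "lead_mon q' \<in> keys q'" by (rule lead_mon_in_keys[OF False])
        have "lead_mon q' \<in> keys q \<or> lead_mon q' \<in> keys (f w)"
          using lead by (auto simp: q'_def in_keys_iff lookup_minus)
        moreover have "lead_mon q' \<noteq> w" using lead q'w by (auto simp: in_keys_iff)
        ultimately have lt: "revlex_less (lead_mon q') w"
          using revlex_lead_mon[of q] revlex_lead_mon[of "f w"] q fw by metis
        have "lead_mon q' \<in> mons r n" using lead keys_mons[OF q'] by blast
        then have "q' \<in> cpoly.span (?S (lead_mon q'))"
          using less(2)[OF _ lt] q' False by blast
        moreover have "?S (lead_mon q') \<subseteq> ?S w" using lt revlex_trans by blast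
        ultimately show ?thesis using cpoly.span_mono by blast
      qed
      then have "q' + single 0 c * f w \<in> cpoly.span (?S w)" using base by (rule cpoly.span_add)
      then show "q \<in> cpoly.span (?S w)" by (simp add: q'_def)
    qed
  qed
  then show ?thesis using q by blast
qed

text \<open>Some x_l divides m / K, so m / x_l is a leading monomial. If l is below k = max m,
  stability exchanges a factor x_k of m / x_l for x_l, which gives m / x_k.\<close>

lemma non_minimal_factor:
  assumes V: "is_ideal r V"
    and stable: "\<And>u i j. u + var j \<in> leads V \<Longrightarrow> 1 \<le> i \<Longrightarrow> i < j \<Longrightarrow> u + var i \<in> leads V"
    and m: "m \<in> leads V" and K: "K \<in> leads V" "mon_dvd K m" "K \<noteq> m"
  obtains m' where "m' \<in> leads V" "m = m' + var (maxvar m)"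
proof -
  let ?k = "maxvar m"
  define e where "e = m - K"
  have me: "m = e + K"
    by (rule poly_mapping_eqI) (use K(2) in \<open>simp add: e_def lookup_add lookup_minus mon_dvd_def\<close>)
  then have "e \<noteq> 0" using K(3) by auto
  then obtain l where "0 < lookup e l" using lookup_maxvar_pos by blast
  then obtain e' where e': "e = e' + var l" by (rule mon_eq_add_var)
  have mr: "mon_in r m" by (rule leads_mon_in[OF V m])
  have L: "e' + K \<in> leads V" using leads_add[OF V K(1)] mr me e' by simp
  have ml: "m = (e' + K) + var l" by (simp add: me e' ac_simps)
  have "l \<le> ?k" by (rule le_maxvar) (simp add: ml lookup_add lookup_var)
  show ?thesis
  proof (cases "l = ?k")
    case True
    then show ?thesis using that L ml by metis
  next
    case False
    then have "l < ?k" using \<open>l \<le> ?k\<close> by simp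
    have "lookup m l \<noteq> 0" by (simp add: ml lookup_add lookup_var)
    then have "m \<noteq> 0" by auto
    then have "0 < lookup m ?k" by (rule lookup_maxvar_pos)
    moreover have "lookup m ?k = lookup (e' + K) ?k"
      using False by (subst ml) (simp add: lookup_add lookup_var)
    ultimately have "0 < lookup (e' + K) ?k" by simp
    then obtain q where q: "e' + K = q + var ?k" by (rule mon_eq_add_var)
    have "1 \<le> l" using mr ml by simp
    then have "q + var l \<in> leads V" using stable[of q ?k l] L q \<open>l < ?k\<close> by simp
    moreover have "m = (q + var l) + var ?k" using ml q by (metis add.assoc add.commute)
    ultimately show ?thesis using that by blast
  qed
qed

text \<open>Genericity has been reduced to stability of the leading monomials; what remains is
  linear algebra in degrees n and \<open>Suc n\<close>.\<close>

lemma new_lead_bound: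
  assumes V: "homog_ideal r V"
    and stable: "\<And>u i j. u + var j \<in> leads V \<Longrightarrow> 1 \<le> i \<Longrightarrow> i < j \<Longrightarrow> u + var i \<in> leads V"
    and gen: "\<And>p. p \<in> V \<Longrightarrow> homog_of_deg (Suc n) p \<Longrightarrow>
      p \<in> cpoly.span {xmon (var i) * f | i f. 1 \<le> i \<and> i \<le> r \<and> f \<in> V \<and> homog_of_deg n f}"
    and P: "P \<in> leads V" "mdeg P = Suc n"
    and new: "\<And>m k. m \<in> leads V \<Longrightarrow> mdeg m = n \<Longrightarrow> P \<noteq> m + var k"
  shows "\<exists>J i. J \<in> leads V \<and> (\<forall>K\<in>leads V. mon_dvd K J \<longrightarrow> K = J) \<and> mdeg J = n \<and>
    1 \<le> i \<and> i < maxvar J \<and> revlex_less P (J + var i)"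
proof (rule ccontr)
  assume contra: "\<not> ?thesis"
  let ?L = "leads V"
  define mg where "mg J \<longleftrightarrow> (\<forall>K\<in>?L. mon_dvd K J \<longrightarrow> K = J)" for J
  have Vid: "is_ideal r V" using V by (simp add: homog_ideal_def)
  have "\<forall>m\<in>?L. \<exists>f. f \<in> V \<and> homog_of_deg (mdeg m) f \<and> f \<noteq> 0 \<and> lead_mon f = m"
    using leads_homogE[OF V] by metis
  from bchoice[OF this] obtain f0 where
    f0: "\<And>m. m \<in> ?L \<Longrightarrow> f0 m \<in> V \<and> homog_of_deg (mdeg m) (f0 m) \<and> f0 m \<noteq> 0 \<and> lead_mon (f0 m) = m"
    by blast
  have xmult: "xmon (var k) * p \<in> V \<and> homog_of_deg (Suc d) (xmon (var k) * p) \<and> xmon (var k) * p \<noteq> 0 \<and>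
      lead_mon (xmon (var k) * p) = lead_mon p + var k"
    if "p \<in> V" "homog_of_deg d p" "p \<noteq> 0" "1 \<le> k" "k \<le> r" for k d p
  proof (intro conjI)
    show "xmon (var k) * p \<in> V" using that by (intro ideal_mult[OF Vid]) simp_all
    show "homog_of_deg (Suc d) (xmon (var k) * p)"
      using homog_mult[OF homog_single[of "var k" 1] that(2)] by (simp add: xmon_def)
    show "xmon (var k) * p \<noteq> 0" unfolding xmon_def by (rule single_mult_neq_0) (use that in simp_all)
    show "lead_mon (xmon (var k) * p) = lead_mon p + var k"
      using that by (simp add: xmon_def lead_mon_single_mult add.commute)
  qed
  have factor: "\<exists>m'. m' \<in> ?L \<and> m = m' + var (maxvar m)" if m: "m \<in> ?L" "\<not> mg m" for m
  proof -
    obtain K where K: "K \<in> ?L" "mon_dvd K m" "K \<noteq> m" using m(2) unfolding mg_def by blast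
    show ?thesis by (rule non_minimal_factor[OF Vid _ m(1) K]) (blast intro: stable)+
  qed
  \<comment> \<open>For a nonminimal m the representative is divisible by x_k with k = max m, so x_i
    times it can be regrouped as x_k times another element of degree n.\<close>
  define f where "f m = (if mg m then f0 m else xmon (var (maxvar m)) * f0 (m - var (maxvar m)))" for m
  have f_nonmin: "\<exists>m'. m' \<in> ?L \<and> m = m' + var (maxvar m) \<and> f m = xmon (var (maxvar m)) * f0 m'"
    if m: "m \<in> ?L" "\<not> mg m" for m
  proof -
    obtain m' where m': "m' \<in> ?L" "m = m' + var (maxvar m)" using factor[OF m] by blast
    then have "m - var (maxvar m) = m'" by (metis add_diff_cancel_right')
    then show ?thesis using m' m by (auto simp: f_def)
  qed
  have maxr: "1 \<le> maxvar m \<and> maxvar m \<le> r" if "m \<in> ?L" "m = m' + var (maxvar m)" for m m'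
    using leads_mon_in[OF Vid that(1)] that(2) by (metis mon_in_add mon_in_var)
  have f: "f m \<in> V \<and> homog_of_deg n (f m) \<and> f m \<noteq> 0 \<and> lead_mon (f m) = m"
    if m: "m \<in> ?L" "mdeg m = n" for m
  proof (cases "mg m")
    case True
    then show ?thesis using f0[OF m(1)] m by (simp add: f_def)
  next
    case False
    obtain m' where m': "m' \<in> ?L" "m = m' + var (maxvar m)" "f m = xmon (var (maxvar m)) * f0 m'"
      using f_nonmin[OF m(1) False] by blast
    have "Suc (mdeg m') = n" using m(2) m'(2) by (metis mdeg_add mdeg_var Suc_eq_plus1)
    then show ?thesis
      using xmult[of "f0 m'" "mdeg m'" "maxvar m"] f0[OF m'(1)] maxr[OF m(1) m'(2)] m' by metis
  qed
  \<comment> \<open>\<open>B1\<close> holds the products with pairwise distinct leading monomials;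
    \<open>B2\<close> holds the remaining products, needed only for minimal generators.\<close>
  define B1 where "B1 = {xmon (var k) * f m | k m. m \<in> ?L \<and> mdeg m = n \<and> maxvar m \<le> k \<and> 1 \<le> k \<and> k \<le> r}"
  define B2 where "B2 = {xmon (var k) * f m | k m. m \<in> ?L \<and> mdeg m = n \<and> mg m \<and> 1 \<le> k \<and> k < maxvar m \<and> k \<le> r}"
  have lead_xf: "lead_mon (xmon (var k) * f m) = m + var k" "xmon (var k) * f m \<noteq> 0"
    if "m \<in> ?L" "mdeg m = n" "1 \<le> k" "k \<le> r" for k m
    using xmult[of "f m" n k] f that by auto
  \<comment> \<open>An Eliahou--Kervaire style reduction: products \<open>x_i f_m\<close> with \<open>i < max m\<close> are only needed for
    minimal generators \<open>m\<close>.\<close>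
  have reduce: "\<forall>i m. m \<in> ?L \<longrightarrow> mdeg m = n \<longrightarrow> 1 \<le> i \<longrightarrow> i \<le> r \<longrightarrow> m + var i = w \<longrightarrow>
      xmon (var i) * f m \<in> cpoly.span (B1 \<union> B2)" if "w \<in> mons r (Suc n)" for w
    using that
  proof (induction rule: revlex_mons_induct)
    case (less w)
    show ?case
    proof (intro allI impI)
      fix i m assume m: "m \<in> ?L" "mdeg m = n" and i: "1 \<le> i" "i \<le> r" and w: "m + var i = w"
      show "xmon (var i) * f m \<in> cpoly.span (B1 \<union> B2)"
      proof (cases "maxvar m \<le> i \<or> mg m")
        case True
        then have "xmon (var i) * f m \<in> B1 \<union> B2"
          unfolding B1_def B2_def using m i by (cases "maxvar m \<le> i") (blast, metis (mono_tags, lifting) UnI2 mem_Collect_eq not_le)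
        then show ?thesis by (rule cpoly.span_base)
      next
        case False
        let ?k = "maxvar m"
        have ik: "i < ?k" and nmg: "\<not> mg m" using False by auto
        obtain m' where m': "m' \<in> ?L" "m = m' + var ?k" "f m = xmon (var ?k) * f0 m'"
          using f_nonmin[OF m(1) nmg] by blast
        have k: "1 \<le> ?k" "?k \<le> r" using maxr[OF m(1) m'(2)] by auto
        have degm': "Suc (mdeg m') = n" using m(2) m'(2) by (metis mdeg_add mdeg_var Suc_eq_plus1)
        \<comment> \<open>Since x_i f_m = x_k (x_i f_m'), the degree n factor is expanded in the
          representatives f_c with c at most x_i m'.\<close>
        let ?q = "xmon (var i) * f0 m'"
        have q: "?q \<in> V" "homog_of_deg n ?q" "?q \<noteq> 0" "lead_mon ?q = m' + var i"
          using xmult[of "f0 m'" "mdeg m'" i] f0[OF m'(1)] i degm' by auto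
        have "?q \<in> cpoly.span {f c | c. c \<in> ?L \<and> mdeg c = n \<and> (c = m' + var i \<or> revlex_less c (m' + var i))}"
          using span_by_leads[OF Vid f q(1-3)] unfolding q(4) .
        then have "xmon (var ?k) * ?q \<in> cpoly.span (B1 \<union> B2)"
        proof (rule span_mult_left)
          fix s assume "s \<in> {f c | c. c \<in> ?L \<and> mdeg c = n \<and> (c = m' + var i \<or> revlex_less c (m' + var i))}"
          then obtain c where c: "s = f c" "c \<in> ?L" "mdeg c = n" "c = m' + var i \<or> revlex_less c (m' + var i)"
            by blast
          show "xmon (var ?k) * s \<in> cpoly.span (B1 \<union> B2)"
          \<comment> \<open>For c = x_i m' no variable of c exceeds x_k, so the product is in
            \<open>B1\<close>. For smaller c the monomial x_k c is below w and the induction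
            hypothesis applies.\<close>
          proof (cases "c = m' + var i")
            case True
            have "lookup m' l = 0" if "?k < l" for l
            proof -
              have "lookup m l = 0" using maxvar_le_iff[of m ?k] that by blast
              then show ?thesis using m'(2) by (metis add_is_0 lookup_add)
            qed
            then have "maxvar c \<le> ?k"
              using ik by (auto simp: maxvar_le_iff True lookup_add lookup_var)
            then have "xmon (var ?k) * s \<in> B1" using c k by (auto simp: B1_def)
            then show ?thesis by (intro cpoly.span_base) blast
          next
            case False
            then have "revlex_less c (m' + var i)" using c by blast
            then have "revlex_less (c + var ?k) ((m' + var i) + var ?k)" by simp
            moreover have "(m' + var i) + var ?k = w"
              using m'(2) w by (metis add.assoc add.commute)
            ultimately have "revlex_less (c + var ?k) w" by simp
            moreover have "c + var ?k \<in> mons r (Suc n)"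
              using c k leads_mon_in[OF Vid c(2)] by (simp add: mons_def mdeg_add)
            ultimately show ?thesis using less(2) c k by blast
          qed
        qed
        then show ?thesis using m'(3) by (simp add: mult.left_commute)
      qed
    qed
  qed
  have xf: "xmon (var i) * f m \<in> cpoly.span (B1 \<union> B2)" if "m \<in> ?L" "mdeg m = n" "1 \<le> i" "i \<le> r" for i m
    using reduce[of "m + var i"] that leads_mon_in[OF Vid that(1)] by (simp add: mons_def mdeg_add)
  obtain p where p: "p \<in> V" "homog_of_deg (Suc n) p" "lead_mon p = P" "p \<noteq> 0"
    using f0[OF P(1)] P(2) by metis
  have "p \<in> cpoly.span (B1 \<union> B2)"
  proof -
    have "{xmon (var i) * q | i q. 1 \<le> i \<and> i \<le> r \<and> q \<in> V \<and> homog_of_deg n q} \<subseteq> cpoly.span (B1 \<union> B2)"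
    proof clarify
      fix i q assume i: "1 \<le> i" "i \<le> r" and q: "q \<in> V" "homog_of_deg n q"
      show "xmon (var i) * q \<in> cpoly.span (B1 \<union> B2)"
      proof (cases "q = 0")
        case False
        show ?thesis
          by (rule span_mult_left[OF span_by_leads[OF Vid f q False]]) (use xf i in auto)
      qed (simp add: cpoly.span_zero)
    qed
    then show ?thesis using gen[OF p(1,2)] cpoly.span_minimal[OF _ cpoly.subspace_span] by blast
  qed
  then obtain h q where hq: "p = h + q" "h \<in> cpoly.span B1" "q \<in> cpoly.span B2"
    unfolding cpoly.span_Un by blast
  \<comment> \<open>If the bound fails, every leading monomial from \<open>B2\<close> is at most P,
    and never equal to P because P is not a variable times a leading monomial of degree n.\<close>
  have q_small: "\<forall>k\<in>keys q. revlex_less k P"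
  proof -
    let ?Z = "{q. \<forall>k\<in>keys q. revlex_less k P} :: cpoly set"
    have "cpoly.subspace ?Z"
      unfolding cpoly.subspace_def
    proof (intro conjI ballI allI)
      show "x + y \<in> ?Z" if "x \<in> ?Z" "y \<in> ?Z" for x y
        using that keys_add[of x y] by blast
      show "single 0 c * x \<in> ?Z" if "x \<in> ?Z" for c x
        using that by (auto simp: in_keys_iff)
    qed simp
    moreover have "B2 \<subseteq> ?Z"
    proof
      fix s assume "s \<in> B2"
      then obtain k m where s: "s = xmon (var k) * f m" "m \<in> ?L" "mdeg m = n" "mg m" "1 \<le> k" "k < maxvar m" "k \<le> r"
        by (auto simp: B2_def)
      have "\<not> revlex_less P (m + var k)" using contra s unfolding mg_def by blast
      then have "revlex_less (m + var k) P" using revlex_total[of P "m + var k"] new[OF s(2,3)] by blast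
      moreover have "k' = m + var k \<or> revlex_less k' (m + var k)" if "k' \<in> keys s" for k'
        using revlex_lead_mon[of s k'] that lead_xf[of m k] s by auto
      ultimately show "s \<in> ?Z" using revlex_trans by blast
    qed
    ultimately show ?thesis using hq(3) cpoly.span_minimal[of B2 ?Z] by blast
  qed
  have "lookup q P = 0" using q_small by (metis in_keys_iff revlex_irrefl)
  moreover have "lookup p P \<noteq> 0" using lead_mon_in_keys[OF p(4)] p(3) by (simp add: in_keys_iff)
  ultimately have hP: "P \<in> keys h" unfolding hq(1) by (simp add: lookup_add in_keys_iff)
  then have h0: "h \<noteq> 0" by auto
  have "lead_mon h \<in> lead_mon ` B1"
  proof (rule lead_mon_in_span[OF hq(2) h0])
    show "0 \<notin> B1" using lead_xf(2) by (fastforce simp: B1_def)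
    show "inj_on lead_mon B1"
    proof (rule inj_onI)
      fix x y assume xy: "x \<in> B1" "y \<in> B1" "lead_mon x = lead_mon y"
      obtain k m where x: "x = xmon (var k) * f m" "m \<in> ?L" "mdeg m = n" "maxvar m \<le> k" "1 \<le> k" "k \<le> r"
        using xy(1) by (auto simp: B1_def)
      obtain k' m' where y: "y = xmon (var k') * f m'" "m' \<in> ?L" "mdeg m' = n" "maxvar m' \<le> k'" "1 \<le> k'" "k' \<le> r"
        using xy(2) by (auto simp: B1_def)
      have eq: "m + var k = m' + var k'" using xy(3) lead_xf(1) x y by simp
      then have "k = k'" using maxvar_add_var[OF x(4)] maxvar_add_var[OF y(4)] by simp
      then show "x = y" using eq x(1) y(1) by simp
    qed
  qed
  \<comment> \<open>The leading monomial of h is a multiple of one of degree n, hence different from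
    P and, as P occurs in h, above P. Nothing in q cancels it, which contradicts that P leads
    p.\<close>
  then obtain k m where lh: "lead_mon h = m + var k" "m \<in> ?L" "mdeg m = n"
    unfolding B1_def using lead_xf(1) by auto
  then have "P \<noteq> lead_mon h" using new by simp
  then have Plt: "revlex_less P (lead_mon h)" using revlex_lead_mon[OF h0 hP] by simp
  then have "lead_mon h \<notin> keys q" using q_small revlex_asym by blast
  then have "lead_mon h \<in> keys p"
    using lead_mon_in_keys[OF h0] unfolding hq(1) by (simp add: in_keys_iff lookup_add)
  then show False using revlex_lead_mon[OF p(4)] p(3) Plt revlex_asym revlex_irrefl by metis
qed

theorem theorem4:
  fixes r n :: nat and I M :: "cpoly set"
  assumes gens: "\<exists>G. G \<subseteq> polyring r \<and> (\<forall>q\<in>G. \<exists>d\<le>n. homog_of_deg d q) \<and> I = ideal_gen r G"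
    and gin: "is_gin r I M"
  shows "\<forall>P. min_gen M P \<and> mdeg P = n + 1 \<longrightarrow>
           (\<exists>J i. min_gen M J \<and> mdeg J = n \<and> 1 \<le> i \<and> i < maxvar J \<and>
                  revlex_less P (J + var i))"
proof (intro allI impI)
  fix P assume P: "min_gen M P \<and> mdeg P = n + 1"
  obtain G where G: "G \<subseteq> polyring r" "\<And>q. q \<in> G \<Longrightarrow> \<exists>d\<le>n. homog_of_deg d q" and I: "I = ideal_gen r G"
    using gens by blast
  obtain F where F: "F \<noteq> 0" "entry_poly r F"
    and M: "\<And>g. Defs.invertible_mat r g \<Longrightarrow> eval_entry F g \<noteq> 0 \<Longrightarrow> initial_ideal r (act r g I) = M"
    using gin unfolding is_gin_def by blast
  obtain g0 where g0: "Defs.invertible_mat r g0" "eval_entry F g0 \<noteq> 0"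
    by (rule exists_generic_invertible[OF F])
  define L where "L = {J. xmon J \<in> M}"
  have Iid: "is_ideal r I" unfolding I by (rule ideal_gen_is_ideal[OF G(1)])
  \<comment> \<open>The whole set of leading monomials is read off from \<open>M\<close>, so it is
    the same for every admissible matrix; this is the form of genericity that stability
    needs.\<close>
  have leads: "leads (act r g I) = L" if "Defs.invertible_mat r g" "eval_entry F g \<noteq> 0" for g
    using xmon_in_initial_ideal_iff[OF act_is_ideal[OF Iid that(1)]] M[OF that] by (auto simp: L_def)
  define V where "V = act r g0 I"
  have LV: "leads V = L" unfolding V_def by (rule leads[OF g0])
  have stable: "u + var i \<in> leads V" if "u + var j \<in> leads V" "1 \<le> i" "i < j" for u i j
    using generic_leads_stable[OF G F(2) g0 leads[unfolded I]] that unfolding LV by blast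
  have Vgen: "V = ideal_gen r (act r g0 G)"
    unfolding V_def I by (rule act_ideal_gen[OF G(1) g0(1)])
  have G': "act r g0 G \<subseteq> polyring r" "\<And>q. q \<in> act r g0 G \<Longrightarrow> \<exists>d\<le>n. homog_of_deg d q"
    using G(2) homog_subst by (fastforce simp: act_def subst_polyring)+
  have V: "homog_ideal r V" unfolding Vgen by (rule homog_ideal_gen(1)[OF G'])
  have gen: "p \<in> cpoly.span {xmon (var i) * f | i f. 1 \<le> i \<and> i \<le> r \<and> f \<in> V \<and> homog_of_deg n f}"
    if "p \<in> V" "homog_of_deg (Suc n) p" for p
    using homog_ideal_gen(2)[OF G'] that unfolding Vgen by blast
  have mg: "min_gen M J \<longleftrightarrow> J \<in> leads V \<and> (\<forall>K\<in>leads V. mon_dvd K J \<longrightarrow> K = J)" for J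
    unfolding min_gen_def LV L_def by blast
  \<comment> \<open>Such an m would divide the minimal generator P, forcing m = P against the
    degrees.\<close>
  have new: "P \<noteq> m + var k" if "m \<in> leads V" "mdeg m = n" for m k
  proof
    assume "P = m + var k"
    then have "mon_dvd m P" by (simp add: mon_dvd_def lookup_add)
    then have "m = P" using P mg that by blast
    then show False using P that by simp
  qed
  have "\<exists>J i. J \<in> leads V \<and> (\<forall>K\<in>leads V. mon_dvd K J \<longrightarrow> K = J) \<and> mdeg J = n \<and>
      1 \<le> i \<and> i < maxvar J \<and> revlex_less P (J + var i)"
  proof (rule new_lead_bound[OF V])
    show "P \<in> leads V" "mdeg P = Suc n" using P mg by auto
  qed (fact stable gen new)+
  then show "\<exists>J i. min_gen M J \<and> mdeg J = n \<and> 1 \<le> i \<and> i < maxvar J \<and> revlex_less P (J + var i)"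
    unfolding mg by blast
qed

end
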